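(* Let $n_L$ be fixed and consider a sequence of asymmetric hub models with $n\to\infty$, $T\to\infty$, satisfying the standing assumption on $\rho$ in the context. Let $d,v\in(0,1]$ (possibly depending on the index of the sequence) be such that: (i) for each $i=1,\dots,n_L$ there exists a set $V_i\subset\{1,\dots,n\}$ with $|V_i|\ge vn/n_L$ and $A_{ij}-A_{i'j}\ge d$ for all $j\in V_i$ and all $i'\in\{1,\dots,n_L\}$, $i'\ne i$; (ii) $A_{ii'}$ is bounded away from $1$ (by a constant) for all $i,i'\in\{1,\dots,n_L\}$, $i\ne i'$. If $(\log T)/(d^2vT)=o(1)$ and $d^4v^2n\to\infty$, then $$T_e/T=o_p(1).$$
   Context: Asymmetric hub model: nodes $1,\dots,n$; leaders (possible hubs) $1,\dots,n_L$ with $n_L\le n$; parameters $\rho=(\rho_1,\dots,\rho_{n_L})$ with $\rho_i\ge0$, $\sum_i\rho_i=1$, and $A\in[0,1]^{n_L\times n}$ with $A_{ii}=1$ for $i\le n_L$. Independently for $t=1,\dots,T$, a latent hub $z_*^{(t)}\in\{1,\dots,n_L\}$ is drawn with $\mathbb P(z_*^{(t)}=i)=\rho_i$, and given $z_*^{(t)}=i$ the variables $G_j^{(t)}\in\{0,1\}$, $j=1,\dots,n$, are independent with $\mathbb P(G_j^{(t)}=1\mid z_*^{(t)}=i)=A_{ij}$. Only $G$ is observed. Profile likelihood estimator: for an assignment $z=(z^{(1)},\dots,z^{(T)})\in\{1,\dots,n_L\}^T$ let $t_i=\sum_t1(z^{(t)}=i)$, $\hat A^z_{ij}=\frac{1}{t_i}\sum_tG_j^{(t)}1(z^{(t)}=i)$,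 and $$L_G(z)=\sum_{t=1}^T\sum_{j=1}^n G_j^{(t)}\log\hat A^z_{z^{(t)},j}+(1-G_j^{(t)})\log(1-\hat A^z_{z^{(t)},j}),\qquad 0\log0=0.$$ An assignment is feasible if $G^{(t)}_{z^{(t)}}=1$ for every $t$ (the assigned hub appears in its group). $\hat z$ is a maximizer of $L_G(z)$ over feasible assignments. $T_e=\sum_t1(z_*^{(t)}\ne\hat z^{(t)})$ is the number of mislabeled groups. Asymptotics: $n,T,\rho,A,d,v$ vary along a sequence while $n_L$ is fixed; $o(1)$ and $o_p(1)$ are along this sequence, and "constant" means independent of the sequence index. Standing assumption: $\min_i\rho_i=c_{\min*}/n_L$ and $\max_i\rho_i=c_{\max*}/n_L$ with positive constants $c_{\min*},c_{\max*}$. *)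

theory Defs
  imports "HOL-Probability.Probability"
begin

text \<open>
  One asymmetric hub model. \<open>Z t\<close> is the latent hub of group \<open>t\<close>, and \<open>G t j\<close> says whether node
  \<open>j\<close> belongs to group \<open>t\<close>. The conditional law given \<open>Z t = i\<close> only makes sense when
  \<open>\<rho> i > 0\<close>; \<open>uniform_measure M E\<close> is the conditional probability measure given the event \<open>E\<close>.
\<close>

locale asymmetric_hub_model = prob_space M
  for M :: "'a measure" +
  fixes n nL T :: nat
    and \<rho> :: "nat \<Rightarrow> real"
    and A :: "nat \<Rightarrow> nat \<Rightarrow> real"
    and Z :: "nat \<Rightarrow> 'a \<Rightarrow> nat"
    and G :: "nat \<Rightarrow> nat \<Rightarrow> 'a \<Rightarrow> bool"
  assumes nL_le_n: "nL \<le> n"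
    and \<rho>_nonneg: "\<And>i. i \<in> {1..nL} \<Longrightarrow> \<rho> i \<ge> 0"
    and \<rho>_sum: "(\<Sum>i=1..nL. \<rho> i) = 1"
    and A_range: "\<And>i j. i \<in> {1..nL} \<Longrightarrow> j \<in> {1..n} \<Longrightarrow> A i j \<in> {0..1}"
    and A_diag: "\<And>i. i \<in> {1..nL} \<Longrightarrow> A i i = 1"
    and Z_rv: "\<And>t. t \<in> {1..T} \<Longrightarrow> random_variable (count_space {1..nL}) (Z t)"
    and G_rv: "\<And>t j. t \<in> {1..T} \<Longrightarrow> j \<in> {1..n} \<Longrightarrow> random_variable (count_space UNIV) (G t j)"
    and groups_indep:
      "indep_vars (\<lambda>_. count_space {1..nL} \<Otimes>\<^sub>M (\<Pi>\<^sub>M j\<in>{1..n}. count_space UNIV))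
         (\<lambda>t \<omega>. (Z t \<omega>, \<lambda>j\<in>{1..n}. G t j \<omega>)) {1..T}"
    and hub_prob:
      "\<And>t i. t \<in> {1..T} \<Longrightarrow> i \<in> {1..nL} \<Longrightarrow> \<P>(\<omega> in M. Z t \<omega> = i) = \<rho> i"
    and members_cond_indep:
      "\<And>t i. t \<in> {1..T} \<Longrightarrow> i \<in> {1..nL} \<Longrightarrow> \<rho> i > 0 \<Longrightarrow>
         prob_space.indep_vars (uniform_measure M {\<omega> \<in> space M. Z t \<omega> = i})
           (\<lambda>_. count_space UNIV) (G t) {1..n}"
    and member_prob:
      "\<And>t i j. t \<in> {1..T} \<Longrightarrow> i \<in> {1..nL} \<Longrightarrow> \<rho> i > 0 \<Longrightarrow> j \<in> {1..n} \<Longrightarrow>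
         \<P>(\<omega> in M. G t j \<omega> \<bar> Z t \<omega> = i) = A i j"

definition label_count :: "nat \<Rightarrow> (nat \<Rightarrow> nat) \<Rightarrow> nat \<Rightarrow> nat" where
  "label_count T z i = card {t \<in> {1..T}. z t = i}"

definition A_hat :: "nat \<Rightarrow> (nat \<Rightarrow> nat \<Rightarrow> bool) \<Rightarrow> (nat \<Rightarrow> nat) \<Rightarrow> nat \<Rightarrow> nat \<Rightarrow> real" where
  "A_hat T g z i j =
     1 / real (label_count T z i) * (\<Sum>t=1..T. of_bool (g t j) * of_bool (z t = i))"

text \<open>
  The convention \<open>0 log 0 = 0\<close> holds because \<open>ln\<close> is total; a logarithm of \<open>0\<close> never occurs here
  with coefficient \<open>1\<close>. Likewise \<open>A_hat\<close> is only used at labels \<open>z t\<close>, which have positive count.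
\<close>

definition profile_loglik ::
    "nat \<Rightarrow> nat \<Rightarrow> (nat \<Rightarrow> nat \<Rightarrow> bool) \<Rightarrow> (nat \<Rightarrow> nat) \<Rightarrow> real" where
  "profile_loglik n T g z =
     (\<Sum>t=1..T. \<Sum>j=1..n. of_bool (g t j) * ln (A_hat T g z (z t) j)
                      + (1 - of_bool (g t j)) * ln (1 - A_hat T g z (z t) j))"

definition feasible :: "nat \<Rightarrow> nat \<Rightarrow> (nat \<Rightarrow> nat \<Rightarrow> bool) \<Rightarrow> (nat \<Rightarrow> nat) \<Rightarrow> bool" where
  "feasible nL T g z \<longleftrightarrow> (\<forall>t\<in>{1..T}. z t \<in> {1..nL} \<and> g t (z t))"

definition profile_mle ::
    "nat \<Rightarrow> nat \<Rightarrow> nat \<Rightarrow> (nat \<Rightarrow> nat \<Rightarrow> bool) \<Rightarrow> (nat \<Rightarrow> nat) \<Rightarrow> bool" where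
  "profile_mle n nL T g z \<longleftrightarrow> is_arg_max (profile_loglik n T g) (feasible nL T g) z"

definition mislabeled :: "nat \<Rightarrow> (nat \<Rightarrow> nat) \<Rightarrow> (nat \<Rightarrow> nat) \<Rightarrow> nat" where
  "mislabeled T z z' = card {t \<in> {1..T}. z t \<noteq> z' t}"

text \<open>\<open>X m = o\<^sub>p(1)\<close>, where \<open>X m\<close> lives on its own probability space \<open>M m\<close>.\<close>

definition vanishes_in_prob :: "(nat \<Rightarrow> 'a measure) \<Rightarrow> (nat \<Rightarrow> 'a \<Rightarrow> real) \<Rightarrow> bool" where
  "vanishes_in_prob M X \<longleftrightarrow>
     (\<forall>\<epsilon>>0. (\<lambda>m. \<P>(\<omega> in M m. \<bar>X m \<omega>\<bar> > \<epsilon>)) \<longlonglongrightarrow> 0)"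

end

theory Submission
  imports Defs
begin

text \<open>
  The exponential of the profile log-likelihood of \<open>z\<close> is the likelihood of the data under labels \<open>z\<close>
  maximized over the parameter matrix. Since the true labels are almost surely feasible, the estimate
  \<open>z\<close> together with its fitted matrix \<open>B\<close> is at least as likely as the true labels \<open>\<zeta>\<close> with the true
  matrix \<open>A\<close>. For fixed \<open>(\<zeta>, z, B)\<close> this has probability at most the Bhattacharyya affinity of the two
  product measures, hence at most \<open>exp (- S / 4)\<close> with
  \<open>S = (\<Sum>t j. (A (\<zeta> t) j - B (z t) j)\<^sup>2)\<close>. There are only \<open>nL ^ T\<close> labelings, and the fitted entries
  are fractions with denominator at most \<open>T\<close>, so a union bound applies as soon as \<open>S\<close> is at least a
  constant times \<open>d\<^sup>2 * v * n * T\<close>. This holds whenever some estimated class contains a positive fraction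
  of two different true classes. Otherwise the estimate is, up to few groups, a relabeling of the
  truth, and the relabeling is the identity: with high probability a positive fraction of the groups
  with hub \<open>a\<close> does not contain \<open>b \<noteq> a\<close>, and feasibility forbids the label \<open>b\<close> for these.
\<close>

subsection \<open>Likelihood of a labeling\<close>

definition bernoulli_mass :: "real \<Rightarrow> bool \<Rightarrow> real" where
  "bernoulli_mass p x = (if x then p else 1 - p)"

definition likelihood ::
    "nat \<Rightarrow> nat \<Rightarrow> (nat \<Rightarrow> nat \<Rightarrow> real) \<Rightarrow> (nat \<Rightarrow> nat) \<Rightarrow> (nat \<Rightarrow> nat \<Rightarrow> bool) \<Rightarrow> real" where
  "likelihood n T B z g = (\<Prod>t=1..T. \<Prod>j=1..n. bernoulli_mass (B (z t) j) (g t j))"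

definition sq_distance ::
    "nat \<Rightarrow> nat \<Rightarrow> (nat \<Rightarrow> nat \<Rightarrow> real) \<Rightarrow> (nat \<Rightarrow> nat) \<Rightarrow> (nat \<Rightarrow> nat \<Rightarrow> real) \<Rightarrow> (nat \<Rightarrow> nat) \<Rightarrow> real" where
  "sq_distance n T A \<zeta> B z = (\<Sum>t=1..T. \<Sum>j=1..n. (A (\<zeta> t) j - B (z t) j)\<^sup>2)"

text \<open>\<open>PiE\<close> fixes the values outside the index ranges, so labelings and groupings
  form finite sets over which sums and union bounds can run.\<close>

abbreviation labelings :: "nat \<Rightarrow> nat \<Rightarrow> (nat \<Rightarrow> nat) set" where
  "labelings nL T \<equiv> PiE {1..T} (\<lambda>_. {1..nL})"

abbreviation groupings :: "nat \<Rightarrow> nat \<Rightarrow> (nat \<Rightarrow> nat \<Rightarrow> bool) set" where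
  "groupings n T \<equiv> PiE {1..T} (\<lambda>_. PiE {1..n} (\<lambda>_. UNIV))"

lemma bernoulli_mass_nonneg: "0 \<le> p \<Longrightarrow> p \<le> 1 \<Longrightarrow> 0 \<le> bernoulli_mass p x"
  by (simp add: bernoulli_mass_def)

lemma sqrt_prod: "sqrt (\<Prod>i\<in>I. f i) = (\<Prod>i\<in>I. sqrt (f i))"
  by (induction I rule: infinite_finite_induct) (simp_all add: real_sqrt_mult)

text \<open>\<open>p - q\<close> factors into the difference and the sum of the square roots, and
  that sum is at most 2.\<close>

lemma square_diff_le_sqrt:
  assumes "0 \<le> p" "p \<le> 1" "0 \<le> q" "q \<le> (1::real)"
  shows "(p - q)\<^sup>2 \<le> 4 * (sqrt p - sqrt q)\<^sup>2"
proof -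
  have "p - q = (sqrt p - sqrt q) * (sqrt p + sqrt q)"
    using assms by (simp add: algebra_simps)
  moreover have "(sqrt p + sqrt q)\<^sup>2 \<le> 2\<^sup>2"
    using assms by (intro power_mono) (auto intro: order_trans[OF add_mono[of "sqrt p" 1 "sqrt q" 1]])
  ultimately show ?thesis
    using mult_left_mono[of "(sqrt p + sqrt q)\<^sup>2" 4 "(sqrt p - sqrt q)\<^sup>2"]
    by (simp add: power_mult_distrib mult.commute)
qed

text \<open>The affinity is 1 minus the squared Hellinger distance, which is half the sum of two
  squared differences of square roots. Each of these squares is at least
  \<open>(p - q)\<^sup>2 / 4\<close> by the preceding bound.\<close>

lemma bernoulli_affinity_le:
  assumes p: "0 \<le> p" "p \<le> 1" and q: "0 \<le> q" "q \<le> 1"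
  shows "(\<Sum>x\<in>UNIV. sqrt (bernoulli_mass p x * bernoulli_mass q x)) \<le> exp (- (p - q)\<^sup>2 / 4)"
proof -
  have 1: "(p - q)\<^sup>2 \<le> 4 * (sqrt p - sqrt q)\<^sup>2"
    using p q by (rule square_diff_le_sqrt)
  have 2: "(p - q)\<^sup>2 \<le> 4 * (sqrt (1 - p) - sqrt (1 - q))\<^sup>2"
    using square_diff_le_sqrt[of "1 - q" "1 - p"] p q by (simp add: power2_commute)
  have "(\<Sum>x\<in>UNIV. sqrt (bernoulli_mass p x * bernoulli_mass q x))
      = sqrt p * sqrt q + sqrt (1 - p) * sqrt (1 - q)"
    by (simp add: UNIV_bool bernoulli_mass_def real_sqrt_mult)
  also have "\<dots> = 1 - ((sqrt p - sqrt q)\<^sup>2 + (sqrt (1 - p) - sqrt (1 - q))\<^sup>2) / 2"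
    using p q by (simp add: power2_diff field_simps)
  also have "\<dots> \<le> 1 + (- (p - q)\<^sup>2 / 4)"
    using 1 2 by simp
  also have "\<dots> \<le> exp (- (p - q)\<^sup>2 / 4)"
    by (rule exp_ge_add_one_self)
  finally show ?thesis .
qed

lemma likelihood_nonneg:
  assumes "\<And>t j. t \<in> {1..T} \<Longrightarrow> j \<in> {1..n} \<Longrightarrow> B (z t) j \<in> {0..1}"
  shows "0 \<le> likelihood n T B z g"
  unfolding likelihood_def using assms by (intro prod_nonneg ballI bernoulli_mass_nonneg) force+

text \<open>Both likelihoods are product masses over the entries \<open>(t, j)\<close>, so the sum
  over all groupings factors into Bernoulli affinities, and the exponents of their bounds add
  up.\<close>

lemma likelihood_affinity_le:
  assumes A: "\<And>t j. t \<in> {1..T} \<Longrightarrow> j \<in> {1..n} \<Longrightarrow> A (\<zeta> t) j \<in> {0..1}"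
    and B: "\<And>t j. t \<in> {1..T} \<Longrightarrow> j \<in> {1..n} \<Longrightarrow> B (z t) j \<in> {0..1}"
  shows "(\<Sum>g\<in>groupings n T. sqrt (likelihood n T A \<zeta> g * likelihood n T B z g))
    \<le> exp (- sq_distance n T A \<zeta> B z / 4)"
proof -
  define w where "w t j x = sqrt (bernoulli_mass (A (\<zeta> t) j) x * bernoulli_mass (B (z t) j) x)" for t j x
  have w_nonneg: "0 \<le> w t j x" if "t \<in> {1..T}" "j \<in> {1..n}" for t j x
    using A[OF that] B[OF that] by (simp add: w_def bernoulli_mass_nonneg)
  have "sqrt (likelihood n T A \<zeta> g * likelihood n T B z g) = (\<Prod>t=1..T. \<Prod>j=1..n. w t j (g t j))" for g
    by (simp add: likelihood_def w_def sqrt_prod flip: prod.distrib)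
  hence "(\<Sum>g\<in>groupings n T. sqrt (likelihood n T A \<zeta> g * likelihood n T B z g))
      = (\<Prod>t=1..T. \<Prod>j=1..n. \<Sum>x\<in>UNIV. w t j x)"
    by (simp add: prod_sum_PiE finite_PiE)
  also have "\<dots> \<le> (\<Prod>t=1..T. \<Prod>j=1..n. exp (- (A (\<zeta> t) j - B (z t) j)\<^sup>2 / 4))"
  proof (intro prod_mono conjI prod_nonneg sum_nonneg)
    fix t j assume "t \<in> {1..T}" "j \<in> {1..n}"
    thus "(\<Sum>x\<in>UNIV. w t j x) \<le> exp (- (A (\<zeta> t) j - B (z t) j)\<^sup>2 / 4)"
      unfolding w_def using A B by (intro bernoulli_affinity_le) force+
  qed (use w_nonneg in auto)
  also have "\<dots> = exp (- sq_distance n T A \<zeta> B z / 4)"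
    by (simp add: sq_distance_def exp_sum[symmetric] sum_negf sum_divide_distrib)
  finally show ?thesis .
qed

section \<open>Class frequencies as maximum likelihood parameters\<close>

lemma A_hat_eq: "A_hat T g z i j = real (card {t\<in>{1..T}. z t = i \<and> g t j}) / real (label_count T z i)"
proof -
  have "(\<Sum>t=1..T. of_bool (g t j) * of_bool (z t = i)) = (\<Sum>t=1..T. of_bool (z t = i \<and> g t j) :: real)"
    by (intro sum.cong) auto
  also have "\<dots> = real (card ({1..T} \<inter> {t. z t = i \<and> g t j}))"
    by simp
  also have "{1..T} \<inter> {t. z t = i \<and> g t j} = {t\<in>{1..T}. z t = i \<and> g t j}"
    by auto
  finally show ?thesis by (simp add: A_hat_def)
qed

lemma A_hat_range: "A_hat T g z i j \<in> {0..1}"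
proof -
  have "card {t\<in>{1..T}. z t = i \<and> g t j} \<le> label_count T z i"
    unfolding label_count_def by (intro card_mono) auto
  thus ?thesis
    by (auto simp: A_hat_eq divide_le_eq)
qed

lemma label_count_pos: "t \<in> {1..T} \<Longrightarrow> 0 < label_count T z (z t)"
  by (auto simp: label_count_def card_gt_0_iff)

lemma A_hat_pos:
  assumes "t \<in> {1..T}" "g t j"
  shows "0 < A_hat T g z (z t) j"
proof -
  have "0 < card {s\<in>{1..T}. z s = z t \<and> g s j}"
    using assms by (auto simp: card_gt_0_iff)
  with label_count_pos[OF assms(1), of z] show ?thesis
    unfolding A_hat_eq by (intro divide_pos_pos) simp_all
qed

lemma A_hat_less_1:
  assumes "t \<in> {1..T}" "\<not> g t j"
  shows "A_hat T g z (z t) j < 1"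
proof -
  have "card {s\<in>{1..T}. z s = z t \<and> g s j} < label_count T z (z t)"
    unfolding label_count_def using assms by (intro psubset_card_mono) auto
  thus ?thesis by (simp add: A_hat_eq)
qed

text \<open>Group \<open>t\<close> itself enters the frequency: if it contains \<open>j\<close>, the
  numerator is positive; if not, the numerator is below the class size.\<close>

lemma bernoulli_mass_A_hat_pos:
  assumes "t \<in> {1..T}"
  shows "0 < bernoulli_mass (A_hat T g z (z t) j) (g t j)"
  using A_hat_pos[of t T g j z] A_hat_less_1[of t T g j z] assms by (simp add: bernoulli_mass_def)

text \<open>In each summand the logarithm with coefficient 1 has a positive argument, so
  \<open>exp\<close> undoes it; the other one is multiplied by 0.\<close>

lemma exp_profile_loglik: "exp (profile_loglik n T g z) = likelihood n T (A_hat T g z) z g"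
proof -
  have "exp (of_bool (g t j) * ln (A_hat T g z (z t) j) + (1 - of_bool (g t j)) * ln (1 - A_hat T g z (z t) j))
      = bernoulli_mass (A_hat T g z (z t) j) (g t j)" if "t \<in> {1..T}" for t j
    using bernoulli_mass_A_hat_pos[OF that, of g z j] by (auto simp: bernoulli_mass_def)
  thus ?thesis
    by (simp add: profile_loglik_def likelihood_def exp_sum)
qed

text \<open>The proof works without logarithms, since entries of \<open>B\<close> may be 0 or 1. The
  ratios \<open>r t j\<close> of masses satisfy \<open>r <= exp (r - 1)\<close>, and for fixed
  \<open>j\<close> their sum over a class is at most the class size, so the product of all ratios is
  at most 1.\<close>

lemma likelihood_le_A_hat:
  assumes z: "\<And>t. t \<in> {1..T} \<Longrightarrow> z t \<in> {1..nL}"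
    and B: "\<And>i j. i \<in> {1..nL} \<Longrightarrow> j \<in> {1..n} \<Longrightarrow> B i j \<in> {0..1}"
  shows "likelihood n T B z g \<le> likelihood n T (A_hat T g z) z g"
proof -
  define r where "r t j = bernoulli_mass (B (z t) j) (g t j) / bernoulli_mass (A_hat T g z (z t) j) (g t j)" for t j
  have sum_le: "(\<Sum>t=1..T. \<Sum>j=1..n. (r t j - 1)) \<le> 0"
  proof -
    have le: "(\<Sum>t\<in>{t\<in>{1..T}. z t = i}. r t j - 1) \<le> 0" if i: "i \<in> {1..nL}" and j: "j \<in> {1..n}" for i j
    proof -
      define S where "S = {t\<in>{1..T}. z t = i}"
      define K where "K = {t\<in>{1..T}. z t = i \<and> g t j}"
      have fin: "finite S" "finite K" "K \<subseteq> S" by (auto simp: S_def K_def)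
      have h: "A_hat T g z i j = real (card K) / real (card S)"
        by (simp add: A_hat_eq label_count_def S_def K_def)
      have le: "card K \<le> card S" using fin by (intro card_mono)
      have b: "0 \<le> B i j" "B i j \<le> 1" using B[OF i j] by auto
      have "(\<Sum>t\<in>S. r t j) = (\<Sum>t\<in>K. r t j) + (\<Sum>t\<in>S - K. r t j)"
        using fin by (simp add: sum.subset_diff add.commute)
      also have "(\<Sum>t\<in>K. r t j) = real (card K) * (B i j / A_hat T g z i j)"
        by (simp add: K_def r_def bernoulli_mass_def)
      \<comment> \<open>Equality holds if \<open>K\<close> is nonempty; otherwise the left side is
        0.\<close>
      also have "\<dots> \<le> real (card S) * B i j"
        using b by (auto simp: h)
      also have "(\<Sum>t\<in>S - K. r t j) = real (card (S - K)) * ((1 - B i j) / (1 - A_hat T g z i j))"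
      proof -
        have "(\<Sum>t\<in>S - K. r t j) = (\<Sum>t\<in>S - K. (1 - B i j) / (1 - A_hat T g z i j))"
          by (intro sum.cong) (auto simp: S_def K_def r_def bernoulli_mass_def)
        thus ?thesis by simp
      qed
      also have "\<dots> \<le> real (card S) * (1 - B i j)"
      proof (cases "card K = card S")
        \<comment> \<open>The denominator may be 0 here, but \<open>S - K\<close> is empty and so is
          the sum.\<close>
        case True
        hence "card (S - K) = 0" using fin by (simp add: card_Diff_subset)
        thus ?thesis using b by simp
      next
        case False
        hence "real (card (S - K)) = real (card S) - real (card K)" "card K < card S"
          using fin le by (simp_all add: card_Diff_subset)
        moreover from this have "1 - A_hat T g z i j = real (card (S - K)) / real (card S)"
          by (simp add: h diff_divide_distrib)
        ultimately show ?thesis by simp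
      qed
      finally have "(\<Sum>t\<in>S. r t j - 1) \<le> 0"
        by (simp add: sum_subtractf algebra_simps)
      thus ?thesis by (simp only: S_def)
    qed
    have group: "(\<Sum>t=1..T. r t j - 1) = (\<Sum>i=1..nL. \<Sum>t\<in>{t\<in>{1..T}. z t = i}. r t j - 1)" for j
      using z by (intro sum.group[symmetric]) auto
    have "(\<Sum>t=1..T. \<Sum>j=1..n. r t j - 1) = (\<Sum>j=1..n. \<Sum>t=1..T. r t j - 1)"
      by (rule sum.swap)
    also have "\<dots> \<le> 0"
      unfolding group by (rule sum_nonpos, rule sum_nonpos, rule le)
    finally show ?thesis .
  qed
  have "(\<Prod>t=1..T. \<Prod>j=1..n. r t j) \<le> (\<Prod>t=1..T. \<Prod>j=1..n. exp (r t j - 1))"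
  proof (intro prod_mono conjI prod_nonneg)
    fix t j assume *: "t \<in> {1..T}" "j \<in> {1..n}"
    show "r t j \<le> exp (r t j - 1)"
      using exp_ge_add_one_self[of "r t j - 1"] by simp
    have "0 \<le> r t j"
      unfolding r_def using B[OF z[OF *(1)] *(2)] A_hat_range[of T g z "z t" j]
      by (intro divide_nonneg_nonneg bernoulli_mass_nonneg) auto
    thus "0 \<le> r t j" "0 \<le> r t j" by auto
  qed
  also have "\<dots> = exp (\<Sum>t=1..T. \<Sum>j=1..n. (r t j - 1))"
    by (simp add: exp_sum)
  also have "\<dots> \<le> 1" using sum_le by simp
  finally have le_1: "(\<Prod>t=1..T. \<Prod>j=1..n. r t j) \<le> 1" .
  have eq: "likelihood n T B z g = likelihood n T (A_hat T g z) z g * (\<Prod>t=1..T. \<Prod>j=1..n. r t j)"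
    unfolding likelihood_def r_def prod.distrib[symmetric]
    using bernoulli_mass_A_hat_pos[of _ T g z] by (intro prod.cong refl) (simp add: less_imp_neq[symmetric])
  show ?thesis
    unfolding eq using likelihood_nonneg[of T n "A_hat T g z" z g] A_hat_range le_1
    by (intro mult_left_le) auto
qed

subsection \<open>Confusion between true and estimated classes\<close>

text \<open>Pigeonhole: \<open>z\<close> splits \<open>S\<close> into \<open>nL\<close> classes,
  which cannot all have size at most \<open>x\<close>.\<close>

lemma large_class_exists:
  assumes fin: "finite S" and z: "\<And>t. t \<in> S \<Longrightarrow> z t \<in> {1..nL}"
    and S: "real nL * x < real (card S)"
  shows "\<exists>b\<in>{1..nL::nat}. x < real (card {t\<in>S. z t = b})"
proof (rule ccontr)
  assume "\<not> ?thesis"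
  hence "(\<Sum>b=1..nL. real (card {t\<in>S. z t = b})) \<le> (\<Sum>b=1..nL. x)"
    by (intro sum_mono) (auto simp: not_less)
  moreover have "card S = (\<Sum>b=1..nL. card {t\<in>S. z t = b})"
    using sum.group[of S "{1..nL}" z "\<lambda>_. 1::nat"] fin z by (simp add: image_subset_iff)
  ultimately show False using S by simp
qed

text \<open>
  If every estimated class were dominated by a single true class, each true class would dominate
  exactly one estimated class, and feasibility forces that class to carry the right label.
\<close>
lemma mixed_class_exists:
  assumes \<zeta>: "\<And>t. t \<in> {1..T} \<Longrightarrow> \<zeta> t \<in> {1..nL}"
    and z: "feasible nL T g z"
    and many: "\<And>a b. a \<in> {1..nL} \<Longrightarrow> b \<in> {1..nL} \<Longrightarrow>
      real nL * x < real (card {t\<in>{1..T}. \<zeta> t = a \<and> (b = a \<or> \<not> g t b)})"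
    and mis: "real nL * (real nL * x) < real (mislabeled T \<zeta> z)"
    and x: "0 \<le> x"
  shows "\<exists>b\<in>{1..nL}. \<exists>a\<in>{1..nL}. \<exists>a'\<in>{1..nL}. a \<noteq> a' \<and>
    x < real (card {t\<in>{1..T}. \<zeta> t = a \<and> z t = b}) \<and> x < real (card {t\<in>{1..T}. \<zeta> t = a' \<and> z t = b})"
proof (rule ccontr)
  let ?N = "\<lambda>a b. card {t\<in>{1..T}. \<zeta> t = a \<and> z t = b}"
  assume "\<not> ?thesis"
  \<comment> \<open>Negated claim: no estimated class shares more than \<open>x\<close> groups with
    two different true classes.\<close>
  hence uniq: "a = a'" if "a \<in> {1..nL}" "a' \<in> {1..nL}" "b \<in> {1..nL}" "x < ?N a b" "x < ?N a' b" for a a' b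
    using that by blast
  have zr: "z t \<in> {1..nL}" "g t (z t)" if "t \<in> {1..T}" for t
    using z that by (auto simp: feasible_def)
  \<comment> \<open>Every true class is large, so by pigeonhole some label is given to more than
    \<open>x\<close> of its groups; \<open>f\<close> will pick such a label.\<close>
  have "\<exists>b\<in>{1..nL}. x < ?N a b" if a: "a \<in> {1..nL}" for a
  proof -
    have "real nL * x < real (card {t\<in>{1..T}. \<zeta> t = a})"
      using many[OF a a] by simp
    thus ?thesis
      using large_class_exists[of "{t\<in>{1..T}. \<zeta> t = a}" z nL x] zr by (simp add: conj_assoc)
  qed
  then obtain f where f: "f a \<in> {1..nL}" "x < ?N a (f a)" if "a \<in> {1..nL}" for a
    by metis
  have "inj_on f {1..nL}"
  proof (rule inj_onI)
    fix a a' assume "a \<in> {1..nL}" "a' \<in> {1..nL}" "f a = f a'"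
    thus "a = a'" using f[of a] f[of a'] uniq[of a a' "f a"] by simp
  qed
  moreover have "f ` {1..nL} \<subseteq> {1..nL}" using f by auto
  ultimately have surj: "f ` {1..nL} = {1..nL}"
    by (intro endo_inj_surj) auto
  \<comment> \<open>As \<open>f\<close> is onto, \<open>b = f a'\<close> for some \<open>a'\<close>;
    then both \<open>a\<close> and \<open>a'\<close> overlap class \<open>b\<close> in more than
    \<open>x\<close> groups, whence \<open>a = a'\<close>.\<close>
  have unique_b: "b = f a" if ab: "a \<in> {1..nL}" "b \<in> {1..nL}" "x < ?N a b" for a b
  proof -
    obtain a' where "a' \<in> {1..nL}" "b = f a'" using surj ab(2) by blast
    thus ?thesis using uniq[of a a' b] f[of a'] ab by simp
  qed
  have f_id: "f a = a" if a: "a \<in> {1..nL}" for a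
  proof (rule ccontr)
    assume ne: "f a \<noteq> a"
    \<comment> \<open>If \<open>f a\<close> differs from \<open>a\<close>, pigeonhole is applied to
      the groups with hub \<open>a\<close> that lack \<open>f a\<close>. It yields a label
      \<open>b\<close> with large overlap, so \<open>b = f a\<close>; but feasibility denies this
      label to all of these groups.\<close>
    let ?S = "{t\<in>{1..T}. \<zeta> t = a \<and> (f a = a \<or> \<not> g t (f a))}"
    obtain b where b: "b \<in> {1..nL}" "x < card {t\<in>?S. z t = b}"
      using large_class_exists[of ?S z nL x] many[OF a f(1)[OF a]] zr by auto
    have "card {t\<in>?S. z t = b} \<le> ?N a b"
      by (intro card_mono) auto
    with b(2) have "x < ?N a b" by linarith
    hence "b = f a" using unique_b a b(1) by blast
    have "t \<notin> {t\<in>?S. z t = b}" for t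
      using zr(2)[of t] ne \<open>b = f a\<close> by auto
    hence "{t\<in>?S. z t = b} = {}" by blast
    hence "card {t\<in>?S. z t = b} = 0" by (simp only: card.empty)
    with b(2) x show False by linarith
  qed
  \<comment> \<open>Pigeonhole is used twice on the mislabeled groups, first by true and then by
    estimated label, which explains the two factors \<open>nL\<close> in the threshold. The
    resulting pair of labels must satisfy \<open>b = f a = a\<close>, contradicting
    mislabeling.\<close>
  let ?M = "{t\<in>{1..T}. \<zeta> t \<noteq> z t}"
  obtain a where a: "a \<in> {1..nL}" "real nL * x < card {t\<in>?M. \<zeta> t = a}"
    using large_class_exists[of ?M \<zeta> nL "real nL * x"] mis \<zeta> by (auto simp: mislabeled_def)
  then obtain b where b: "b \<in> {1..nL}" "x < card {t\<in>{t\<in>?M. \<zeta> t = a}. z t = b}"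
    using large_class_exists[of "{t\<in>?M. \<zeta> t = a}" z nL x] zr by auto
  have "card {t\<in>{t\<in>?M. \<zeta> t = a}. z t = b} \<le> ?N a b"
    by (intro card_mono) auto
  with b(2) have "x < ?N a b" by linarith
  hence "b = a" using unique_b[OF a(1) b(1)] f_id[OF a(1)] by simp
  hence "{t\<in>{t\<in>?M. \<zeta> t = a}. z t = b} = {}" by auto
  hence "card {t\<in>{t\<in>?M. \<zeta> t = a}. z t = b} = 0" by (simp only: card.empty)
  with b(2) x show False by linarith
qed

text \<open>One row \<open>B b\<close> cannot be close to two rows of \<open>A\<close> that are at
  least \<open>d\<close> apart. A mixed class contains more than \<open>x\<close> groups of each of
  two true classes, and the separating set supplies at least \<open>y\<close> columns. The bound is
  uniform in \<open>B\<close>, so it applies to the fitted matrix.\<close>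

lemma sq_distance_ge:
  assumes \<zeta>: "\<And>t. t \<in> {1..T} \<Longrightarrow> \<zeta> t \<in> {1..nL}"
    and z: "feasible nL T g z"
    and many: "\<And>a b. a \<in> {1..nL} \<Longrightarrow> b \<in> {1..nL} \<Longrightarrow>
      real nL * x < real (card {t\<in>{1..T}. \<zeta> t = a \<and> (b = a \<or> \<not> g t b)})"
    and mis: "real nL * (real nL * x) < real (mislabeled T \<zeta> z)"
    and d: "0 \<le> d" and x: "0 \<le> x"
    and sep: "\<And>i. i \<in> {1..nL} \<Longrightarrow> \<exists>V\<subseteq>{1..n}. y \<le> real (card V) \<and>
            (\<forall>j\<in>V. \<forall>i'\<in>{1..nL}. i' \<noteq> i \<longrightarrow> A i j - A i' j \<ge> d)"
  shows "x * y * d\<^sup>2 / 2 \<le> sq_distance n T A \<zeta> B z"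
proof -
  obtain a a' b where ab: "a \<in> {1..nL}" "a' \<in> {1..nL}" "b \<in> {1..nL}" "a \<noteq> a'"
    and N: "x < real (card {t\<in>{1..T}. \<zeta> t = a \<and> z t = b})" "x < real (card {t\<in>{1..T}. \<zeta> t = a' \<and> z t = b})"
    using mixed_class_exists[OF \<zeta> z many mis x] by blast
  obtain V where V: "V \<subseteq> {1..n}" "y \<le> real (card V)" and Vd: "\<And>j. j \<in> V \<Longrightarrow> d \<le> A a j - A a' j"
    using sep[OF ab(1)] ab by metis
  define S where "S = {t\<in>{1..T}. \<zeta> t = a \<and> z t = b}"
  define S' where "S' = {t\<in>{1..T}. \<zeta> t = a' \<and> z t = b}"
  have finV: "finite V" using V finite_subset by blast
  have fin: "finite S" "finite S'" "S \<inter> S' = {}" "S \<union> S' \<subseteq> {1..T}"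
    using ab by (auto simp: S_def S'_def)
  have "x * y * d\<^sup>2 / 2 \<le> x * real (card V) * d\<^sup>2 / 2"
    using V x by (intro divide_right_mono mult_right_mono mult_left_mono) auto
  also have "\<dots> = (\<Sum>j\<in>V. x * (d\<^sup>2 / 2))" by simp
  also have "\<dots> \<le> (\<Sum>j\<in>V. x * ((A a j - B b j)\<^sup>2 + (A a' j - B b j)\<^sup>2))"
  proof (intro sum_mono mult_left_mono x)
    fix j assume j: "j \<in> V"
    have "d\<^sup>2 \<le> (A a j - A a' j)\<^sup>2" using Vd[OF j] d by (intro power_mono)
    also have "\<dots> \<le> 2 * ((A a j - B b j)\<^sup>2 + (A a' j - B b j)\<^sup>2)"
      \<comment> \<open>The two sides of the inequality differ by exactly the square shown
        here.\<close>
      using zero_le_power2[of "(A a j - B b j) + (A a' j - B b j)"]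
      by (simp add: power2_eq_square algebra_simps)
    finally show "d\<^sup>2 / 2 \<le> (A a j - B b j)\<^sup>2 + (A a' j - B b j)\<^sup>2" by simp
  qed
  also have "\<dots> \<le> (\<Sum>j\<in>V. real (card S) * (A a j - B b j)\<^sup>2 + real (card S') * (A a' j - B b j)\<^sup>2)"
    using N by (intro sum_mono) (auto simp: distrib_left S_def S'_def intro!: add_mono mult_right_mono)
  also have "\<dots> = (\<Sum>j\<in>V. (\<Sum>t\<in>S. (A (\<zeta> t) j - B (z t) j)\<^sup>2) + (\<Sum>t\<in>S'. (A (\<zeta> t) j - B (z t) j)\<^sup>2))"
    by (simp add: S_def S'_def)
  also have "\<dots> = (\<Sum>j\<in>V. \<Sum>t\<in>S \<union> S'. (A (\<zeta> t) j - B (z t) j)\<^sup>2)"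
    using fin by (simp add: sum.union_disjoint)
  also have "\<dots> \<le> (\<Sum>j=1..n. \<Sum>t\<in>S \<union> S'. (A (\<zeta> t) j - B (z t) j)\<^sup>2)"
    using V by (intro sum_mono2 sum_nonneg) auto
  also have "\<dots> \<le> (\<Sum>j=1..n. \<Sum>t=1..T. (A (\<zeta> t) j - B (z t) j)\<^sup>2)"
    using fin by (intro sum_mono sum_mono2) auto
  also have "\<dots> = sq_distance n T A \<zeta> B z"
    unfolding sq_distance_def by (rule sum.swap)
  finally show ?thesis .
qed

subsection \<open>Union bound over labelings and fitted parameters\<close>

text \<open>The possible values of a fitted entry, a count divided by a class size. An empty class
  gives \<open>q = 0\<close> and the value 0. Restricting to this finite set replaces a continuum of
  parameters at a cost of at most \<open>(T + 1)\<^sup>2\<close> per entry.\<close>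

definition fraction_grid :: "nat \<Rightarrow> real set" where
  "fraction_grid T = (\<lambda>(p, q). real p / real q) ` {(p, q). p \<le> q \<and> q \<le> T}"

abbreviation grid_params :: "nat \<Rightarrow> nat \<Rightarrow> nat \<Rightarrow> (nat \<Rightarrow> nat \<Rightarrow> real) set" where
  "grid_params n nL T \<equiv> PiE {1..nL} (\<lambda>_. PiE {1..n} (\<lambda>_. fraction_grid T))"

lemma fraction_grid_finite: "finite (fraction_grid T)"
  and card_fraction_grid: "card (fraction_grid T) \<le> (T + 1)\<^sup>2"
proof -
  have sub: "{(p, q). p \<le> q \<and> q \<le> T} \<subseteq> {..T} \<times> {..T}" by auto
  hence fin: "finite {(p, q). p \<le> q \<and> q \<le> T}" by (rule finite_subset) simp
  thus "finite (fraction_grid T)" by (simp add: fraction_grid_def)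
  have "card (fraction_grid T) \<le> card {(p, q). p \<le> q \<and> q \<le> T}"
    unfolding fraction_grid_def by (rule card_image_le[OF fin])
  also have "\<dots> \<le> card ({..T} \<times> {..T})"
    using sub by (intro card_mono) auto
  finally show "card (fraction_grid T) \<le> (T + 1)\<^sup>2"
    by (simp add: card_cartesian_product power2_eq_square)
qed

lemma fraction_grid_range: "x \<in> fraction_grid T \<Longrightarrow> x \<in> {0..1}"
  by (auto simp: fraction_grid_def divide_le_eq)

lemma A_hat_in_fraction_grid: "A_hat T g z i j \<in> fraction_grid T"
proof -
  have "card {t\<in>{1..T}. z t = i \<and> g t j} \<le> label_count T z i"
    unfolding label_count_def by (intro card_mono) auto
  moreover have "label_count T z i \<le> card {1..T}"
    unfolding label_count_def by (intro card_mono) auto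
  ultimately show ?thesis
    unfolding A_hat_eq fraction_grid_def by (intro image_eqI[where x = "(card {t\<in>{1..T}. z t = i \<and> g t j}, label_count T z i)"]) auto
qed

lemma card_grid_params: "real (card (grid_params n nL T)) \<le> (real T + 1) ^ (2 * n * nL)"
proof -
  have "card (grid_params n nL T) = card (fraction_grid T) ^ (n * nL)"
    by (simp add: card_PiE power_mult)
  also have "\<dots> \<le> ((T + 1)\<^sup>2) ^ (n * nL)"
    by (intro power_mono card_fraction_grid) simp
  also have "\<dots> = (T + 1) ^ (2 * n * nL)"
    by (simp add: power_mult mult.assoc)
  finally have "real (card (grid_params n nL T)) \<le> real ((T + 1) ^ (2 * n * nL))"
    by (rule of_nat_mono)
  thus ?thesis by (simp add: add.commute)
qed

text \<open>This and the next lemma allow random labels and memberships to be replaced by their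
  restrictions to the index ranges.\<close>

lemma likelihood_cong:
  assumes "\<And>t j. t \<in> {1..T} \<Longrightarrow> j \<in> {1..n} \<Longrightarrow> B (z t) j = B' (z' t) j \<and> g t j = g' t j"
  shows "likelihood n T B z g = likelihood n T B' z' g'"
  unfolding likelihood_def by (intro prod.cong refl) (simp add: assms)

lemma sq_distance_cong:
  assumes "\<And>t j. t \<in> {1..T} \<Longrightarrow> j \<in> {1..n} \<Longrightarrow> A (\<zeta> t) j = A' (\<zeta>' t) j \<and> B (z t) j = B' (z' t) j"
  shows "sq_distance n T A \<zeta> B z = sq_distance n T A' \<zeta>' B' z'"
  unfolding sq_distance_def by (intro sum.cong refl) (simp add: assms)

section \<open>Joint law of latent hubs and memberships\<close>

context asymmetric_hub_model
begin

definition cylinder :: "(nat \<Rightarrow> nat) \<Rightarrow> (nat \<Rightarrow> nat \<Rightarrow> bool) \<Rightarrow> 'a set" where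
  "cylinder \<zeta> g = {\<omega>\<in>space M. \<forall>t\<in>{1..T}. Z t \<omega> = \<zeta> t \<and> (\<forall>j\<in>{1..n}. G t j \<omega> = g t j)}"

lemma Z_measurable: "t \<in> {1..T} \<Longrightarrow> Z t \<in> measurable M (count_space UNIV)"
  by (rule measurable_compose[OF Z_rv]) (auto simp: measurable_count_space_eq1)

lemma Z_range: "t \<in> {1..T} \<Longrightarrow> \<omega> \<in> space M \<Longrightarrow> Z t \<omega> \<in> {1..nL}"
  using measurable_space[OF Z_rv, of t \<omega>] by simp

lemma hub_event_sets: "t \<in> {1..T} \<Longrightarrow> {\<omega>\<in>space M. Z t \<omega> = i} \<in> events"
  using Z_measurable[of t] by measurable

lemma member_event_sets: "t \<in> {1..T} \<Longrightarrow> j \<in> {1..n} \<Longrightarrow> {\<omega>\<in>space M. G t j \<omega> = x} \<in> events"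
  using G_rv[of t j] by measurable

lemma group_event_sets:
  assumes "t \<in> {1..T}"
  shows "{\<omega>\<in>space M. Z t \<omega> = i \<and> (\<forall>j\<in>{1..n}. G t j \<omega> = h j)} \<in> events"
proof -
  have all: "{\<omega>\<in>space M. \<forall>j\<in>{1..n}. G t j \<omega> = h j} \<in> events"
    by (rule sets.sets_Collect_finite_All) (use member_event_sets[OF assms] in auto)
  have "{\<omega>\<in>space M. Z t \<omega> = i \<and> (\<forall>j\<in>{1..n}. G t j \<omega> = h j)}
      = {\<omega>\<in>space M. Z t \<omega> = i} \<inter> {\<omega>\<in>space M. \<forall>j\<in>{1..n}. G t j \<omega> = h j}" by auto
  thus ?thesis
    using hub_event_sets[OF assms] all by (simp only: sets.Int)
qed

lemma cylinder_sets: "cylinder \<zeta> g \<in> events"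
  unfolding cylinder_def by (rule sets.sets_Collect_finite_All[OF group_event_sets]) auto

lemma prob_hub_member:
  assumes t: "t \<in> {1..T}" and i: "i \<in> {1..nL}" and j: "j \<in> {1..n}"
  shows "prob {\<omega>\<in>space M. Z t \<omega> = i \<and> G t j \<omega> = x} = \<rho> i * bernoulli_mass (A i j) x"
proof -
  have True_case: "prob {\<omega>\<in>space M. Z t \<omega> = i \<and> G t j \<omega>} = \<rho> i * A i j"
  proof (cases "\<rho> i > 0")
    case True
    thus ?thesis
      using member_prob[OF t i True j] hub_prob[OF t i]
      by (simp add: cond_prob_def field_simps conj_commute)
  next
    \<comment> \<open>The model leaves the conditional law open here, but both sides vanish.\<close>
    case False
    hence "\<rho> i = 0" using \<rho>_nonneg[OF i] by simp
    moreover have "prob {\<omega>\<in>space M. Z t \<omega> = i \<and> G t j \<omega>} \<le> prob {\<omega>\<in>space M. Z t \<omega> = i}"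
      using hub_event_sets[OF t] by (intro finite_measure_mono) auto
    ultimately show ?thesis
      using hub_prob[OF t i] by (simp add: antisym)
  qed
  show ?thesis
  proof (cases x)
    case True
    thus ?thesis using True_case by (simp add: bernoulli_mass_def)
  next
    case False
    have "{\<omega>\<in>space M. Z t \<omega> = i \<and> G t j \<omega>}
        = {\<omega>\<in>space M. Z t \<omega> = i} \<inter> {\<omega>\<in>space M. G t j \<omega> = True}" by auto
    hence ev: "{\<omega>\<in>space M. Z t \<omega> = i \<and> G t j \<omega>} \<in> events"
      using hub_event_sets[OF t, of i] member_event_sets[OF t j, of True] by (simp only: sets.Int)
    have "prob {\<omega>\<in>space M. Z t \<omega> = i \<and> \<not> G t j \<omega>}
        = prob ({\<omega>\<in>space M. Z t \<omega> = i} - {\<omega>\<in>space M. Z t \<omega> = i \<and> G t j \<omega>})"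
      by (rule arg_cong[where f = prob]) auto
    also have "\<dots> = \<rho> i - \<rho> i * A i j"
      using hub_event_sets[OF t, of i] ev hub_prob[OF t i] True_case
      by (subst finite_measure_Diff) auto
    finally show ?thesis using False by (simp add: bernoulli_mass_def algebra_simps)
  qed
qed

lemma prob_group_le:
  assumes t: "t \<in> {1..T}" and i: "i \<in> {1..nL}"
  shows "prob {\<omega>\<in>space M. Z t \<omega> = i \<and> (\<forall>j\<in>{1..n}. G t j \<omega> = h j)}
    \<le> \<rho> i * (\<Prod>j=1..n. bernoulli_mass (A i j) (h j))"
proof (cases "\<rho> i > 0")
  case False
  hence "\<rho> i = 0" using \<rho>_nonneg[OF i] by simp
  moreover have "prob {\<omega>\<in>space M. Z t \<omega> = i \<and> (\<forall>j\<in>{1..n}. G t j \<omega> = h j)} \<le> prob {\<omega>\<in>space M. Z t \<omega> = i}"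
    using hub_event_sets[OF t] by (intro finite_measure_mono) auto
  ultimately show ?thesis using hub_prob[OF t i] by simp
next
  case True
  let ?E = "{\<omega>\<in>space M. Z t \<omega> = i}"
  let ?U = "uniform_measure M ?E"
  have pE: "prob ?E = \<rho> i" using hub_prob[OF t i] .
  have E0: "emeasure M ?E \<noteq> 0" using True pE by (simp add: emeasure_eq_measure)
  have Einf: "emeasure M ?E \<noteq> \<infinity>" by simp
  interpret U: prob_space ?U using E0 Einf by (rule prob_space_uniform_measure)
  have meas: "U.prob B = prob (?E \<inter> B) / \<rho> i" if "B \<in> events" for B
    using measure_uniform_measure[OF E0 Einf that] pE by simp
  \<comment> \<open>From \<open>i <= nL <= n\<close>: the node set is nonempty, as the intersections
    and the product rule below require.\<close>
  have n1: "1 \<in> {1..n}" using i nL_le_n by auto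
  have "prob {\<omega>\<in>space M. Z t \<omega> = i \<and> (\<forall>j\<in>{1..n}. G t j \<omega> = h j)}
      = prob (?E \<inter> (\<Inter>j\<in>{1..n}. G t j -` {h j} \<inter> space M))"
    using n1 by (intro arg_cong[where f = prob]) auto
  also have "\<dots> = \<rho> i * U.prob (\<Inter>j\<in>{1..n}. G t j -` {h j} \<inter> space M)"
  proof -
    have "(\<Inter>j\<in>{1..n}. G t j -` {h j} \<inter> space M) \<in> events"
      using G_rv[OF t] n1 by (intro sets.finite_INT) auto
    thus ?thesis using meas True by simp
  qed
  also have "U.prob (\<Inter>j\<in>{1..n}. G t j -` {h j} \<inter> space M) = (\<Prod>j=1..n. U.prob (G t j -` {h j} \<inter> space M))"
    using U.indep_varsD_finite[OF members_cond_indep[OF t i True], of "\<lambda>j. {h j}"] n1 by auto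
  also have "\<dots> = (\<Prod>j=1..n. bernoulli_mass (A i j) (h j))"
  proof (intro prod.cong refl)
    fix j assume j: "j \<in> {1..n}"
    have "U.prob (G t j -` {h j} \<inter> space M) = prob (?E \<inter> (G t j -` {h j} \<inter> space M)) / \<rho> i"
      using G_rv[OF t j] by (intro meas) auto
    also have "?E \<inter> (G t j -` {h j} \<inter> space M) = {\<omega>\<in>space M. Z t \<omega> = i \<and> G t j \<omega> = h j}"
      by auto
    finally show "U.prob (G t j -` {h j} \<inter> space M) = bernoulli_mass (A i j) (h j)"
      using prob_hub_member[OF t i j] True by simp
  qed
  finally show ?thesis by simp
qed

lemma prob_cylinder_le:
  assumes \<zeta>: "\<zeta> \<in> labelings nL T" and g: "g \<in> groupings n T"
  shows "prob (cylinder \<zeta> g) \<le> (\<Prod>t=1..T. \<rho> (\<zeta> t)) * likelihood n T A \<zeta> g"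
proof (cases "T = 0")
  \<comment> \<open>The product rule for independent events requires a nonempty index set; for
    \<open>T = 0\<close> the right side is 1.\<close>
  case True
  thus ?thesis by (simp add: likelihood_def)
next
  case False
  define X where "X t \<omega> = (Z t \<omega>, \<lambda>j\<in>{1..n}. G t j \<omega>)" for t \<omega>
  let ?N = "count_space {1..nL} \<Otimes>\<^sub>M (\<Pi>\<^sub>M j\<in>{1..n}. count_space UNIV)"
  \<comment> \<open>The row \<open>g t\<close> is extensional, so agreement on \<open>{1..n}\<close>
    already means equality with the restricted membership vector.\<close>
  have X_eq: "X t -` {(\<zeta> t, g t)} \<inter> space M = {\<omega>\<in>space M. Z t \<omega> = \<zeta> t \<and> (\<forall>j\<in>{1..n}. G t j \<omega> = g t j)}"
    if t: "t \<in> {1..T}" for t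
  proof -
    have "(\<lambda>j\<in>{1..n}. G t j \<omega>) = g t \<longleftrightarrow> (\<forall>j\<in>{1..n}. G t j \<omega> = g t j)" for \<omega>
    proof
      assume "(\<lambda>j\<in>{1..n}. G t j \<omega>) = g t"
      from fun_cong[OF this] show "\<forall>j\<in>{1..n}. G t j \<omega> = g t j"
        by (metis restrict_apply')
    next
      assume "\<forall>j\<in>{1..n}. G t j \<omega> = g t j"
      thus "(\<lambda>j\<in>{1..n}. G t j \<omega>) = g t"
        using PiE_mem[OF g t] by (intro extensionalityI[of _ "{1..n}"]) (auto simp: PiE_iff)
    qed
    thus ?thesis by (auto simp: X_def)
  qed
  have single: "{(\<zeta> t, g t)} \<in> sets ?N" if t: "t \<in> {1..T}" for t
  proof -
    have "{g t} = PiE {1..n} (\<lambda>j. {g t j})"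
      using PiE_mem[OF g t] by (subst PiE_singleton) (auto simp: PiE_iff)
    hence "{g t} \<in> sets (\<Pi>\<^sub>M j\<in>{1..n}. count_space (UNIV :: bool set))"
      by (auto intro!: sets_PiM_I_finite)
    moreover have "{\<zeta> t} \<in> sets (count_space {1..nL})"
      using \<zeta> t by auto
    ultimately have "{\<zeta> t} \<times> {g t} \<in> sets ?N" by (intro pair_measureI)
    thus ?thesis by simp
  qed
  have "1 \<in> {1..T}" using False by auto
  hence "cylinder \<zeta> g
      = (\<Inter>t\<in>{1..T}. {\<omega>\<in>space M. Z t \<omega> = \<zeta> t \<and> (\<forall>j\<in>{1..n}. G t j \<omega> = g t j)})"
    unfolding cylinder_def by blast
  also have "\<dots> = (\<Inter>t\<in>{1..T}. X t -` {(\<zeta> t, g t)} \<inter> space M)"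
    by (intro INF_cong refl X_eq[symmetric])
  also have "prob \<dots> = (\<Prod>t=1..T. prob (X t -` {(\<zeta> t, g t)} \<inter> space M))"
    unfolding X_def
    by (rule indep_varsD_finite[OF groups_indep _ _ single]) (use False in auto)
  also have "\<dots> = (\<Prod>t=1..T. prob {\<omega>\<in>space M. Z t \<omega> = \<zeta> t \<and> (\<forall>j\<in>{1..n}. G t j \<omega> = g t j)})"
    by (intro prod.cong refl arg_cong[where f = prob] X_eq)
  also have "\<dots> \<le> (\<Prod>t=1..T. \<rho> (\<zeta> t) * (\<Prod>j=1..n. bernoulli_mass (A (\<zeta> t) j) (g t j)))"
    using \<zeta> by (intro prod_mono conjI measure_nonneg prob_group_le) auto
  finally show ?thesis
    by (simp add: likelihood_def prod.distrib)
qed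

text \<open>Configurations for which some distant competitor \<open>(z, B)\<close> explains the data
  at least as well as the truth. Quantifying over all competitors removes the dependence on the
  estimator and leaves a finite union of cylinders.\<close>

definition fit_exceptions :: "real \<Rightarrow> ((nat \<Rightarrow> nat) \<times> (nat \<Rightarrow> nat \<Rightarrow> bool)) set" where
  "fit_exceptions D = {(\<zeta>, g) \<in> labelings nL T \<times> groupings n T.
     \<exists>z\<in>labelings nL T. \<exists>B\<in>grid_params n nL T.
       D \<le> sq_distance n T A \<zeta> B z \<and> likelihood n T A \<zeta> g \<le> likelihood n T B z g}"

lemma fit_exceptions_subset: "fit_exceptions D \<subseteq> labelings nL T \<times> groupings n T"
  unfolding fit_exceptions_def by blast

lemma finite_fit_exceptions: "finite (fit_exceptions D)"
  by (rule finite_subset[OF fit_exceptions_subset])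
    (intro finite_cartesian_product finite_PiE finite_atLeastAtMost finite)

lemma A_label_range: "\<zeta> \<in> labelings nL T \<Longrightarrow> t \<in> {1..T} \<Longrightarrow> j \<in> {1..n} \<Longrightarrow> A (\<zeta> t) j \<in> {0..1}"
  using A_range[of "\<zeta> t" j] PiE_mem[of \<zeta> "{1..T}" "\<lambda>_. {1..nL}" t] by blast

lemma grid_params_label_range:
  assumes "z \<in> labelings nL T" "B \<in> grid_params n nL T" "t \<in> {1..T}" "j \<in> {1..n}"
  shows "B (z t) j \<in> {0..1}"
proof -
  have "z t \<in> {1..nL}" using assms(1,3) by (rule PiE_mem)
  with assms(2) have "B (z t) \<in> PiE {1..n} (\<lambda>_. fraction_grid T)" by (rule PiE_mem)
  hence "B (z t) j \<in> fraction_grid T" using assms(4) by (rule PiE_mem)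
  thus ?thesis by (rule fraction_grid_range)
qed

text \<open>On an exceptional configuration the true likelihood is at most its geometric mean with
  that of some distant competitor, hence at most the sum of these means over all distant
  competitors. Summing over \<open>g\<close> gives affinities of at most
  \<open>exp (- D / 4)\<close>, and the remaining factor counts competitors.\<close>

lemma prob_fit_exceptions_le:
  "prob (\<Union>(\<zeta>, g)\<in>fit_exceptions D. cylinder \<zeta> g)
    \<le> real nL ^ T * (real T + 1) ^ (2 * n * nL) * exp (- D / 4)"
proof -
  let ?L = "labelings nL T" and ?\<G> = "groupings n T"
  let ?Q = "?L \<times> grid_params n nL T"
  define w where "w \<zeta> = (\<Prod>t=1..T. \<rho> (\<zeta> t))" for \<zeta>
  \<comment> \<open>Competitors that are too close contribute 0, so the sum can run over all of
    \<open>?Q\<close>.\<close>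
  define q where "q \<zeta> g zB = (if D \<le> sq_distance n T A \<zeta> (snd zB) (fst zB)
    then sqrt (likelihood n T A \<zeta> g * likelihood n T (snd zB) (fst zB) g) else 0)" for \<zeta> g zB
  have fin: "finite ?L" "finite ?\<G>" "finite ?Q"
    by (intro finite_cartesian_product finite_PiE finite_atLeastAtMost finite fraction_grid_finite)+
  have w_nonneg: "0 \<le> w \<zeta>" if "\<zeta> \<in> ?L" for \<zeta>
    unfolding w_def by (intro prod_nonneg ballI \<rho>_nonneg) (rule PiE_mem[OF that])
  have lik_A: "0 \<le> likelihood n T A \<zeta> g" if "\<zeta> \<in> ?L" for \<zeta> g
    by (rule likelihood_nonneg) (rule A_label_range[OF that])
  have B_range: "snd zB (fst zB t) j \<in> {0..1}" if "zB \<in> ?Q" "t \<in> {1..T}" "j \<in> {1..n}" for zB t j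
    using grid_params_label_range[of "fst zB" "snd zB" t j] that unfolding mem_Times_iff by blast
  have lik_B: "0 \<le> likelihood n T (snd zB) (fst zB) g" if "zB \<in> ?Q" for zB g
    by (rule likelihood_nonneg) (rule B_range[OF that])
  have q_nonneg: "0 \<le> q \<zeta> g zB" if "\<zeta> \<in> ?L" "zB \<in> ?Q" for \<zeta> g zB
    using lik_A[OF that(1), of g] lik_B[OF that(2), of g] by (simp add: q_def)
  have lik_le: "likelihood n T A \<zeta> g \<le> (\<Sum>zB\<in>?Q. q \<zeta> g zB)" if K: "(\<zeta>, g) \<in> fit_exceptions D" for \<zeta> g
  proof -
    obtain z B where zB: "z \<in> ?L" "B \<in> grid_params n nL T" "D \<le> sq_distance n T A \<zeta> B z"
        "likelihood n T A \<zeta> g \<le> likelihood n T B z g" and \<zeta>: "\<zeta> \<in> ?L"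
      using K unfolding fit_exceptions_def by blast
    have "likelihood n T A \<zeta> g \<le> sqrt (likelihood n T A \<zeta> g * likelihood n T B z g)"
      using zB(4) lik_A[OF \<zeta>, of g] by (intro real_le_rsqrt) (auto simp: power2_eq_square intro: mult_left_mono)
    also have "\<dots> = q \<zeta> g (z, B)" using zB by (simp add: q_def)
    also have "\<dots> \<le> (\<Sum>zB\<in>?Q. q \<zeta> g zB)"
      using zB(1,2) by (intro member_le_sum SigmaI q_nonneg \<zeta> fin(3)) blast+
    finally show ?thesis .
  qed
  have q_sum: "(\<Sum>g\<in>?\<G>. q \<zeta> g zB) \<le> exp (- D / 4)" if "\<zeta> \<in> ?L" "zB \<in> ?Q" for \<zeta> zB
  proof (cases "D \<le> sq_distance n T A \<zeta> (snd zB) (fst zB)")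
    case True
    hence "(\<Sum>g\<in>?\<G>. q \<zeta> g zB)
        = (\<Sum>g\<in>?\<G>. sqrt (likelihood n T A \<zeta> g * likelihood n T (snd zB) (fst zB) g))"
      by (simp add: q_def)
    also have "\<dots> \<le> exp (- sq_distance n T A \<zeta> (snd zB) (fst zB) / 4)"
      by (rule likelihood_affinity_le) (rule A_label_range[OF that(1)] B_range[OF that(2)]; assumption)+
    also have "\<dots> \<le> exp (- D / 4)" using True by simp
    finally show ?thesis .
  qed (simp add: q_def)
  have "prob (\<Union>(\<zeta>, g)\<in>fit_exceptions D. cylinder \<zeta> g) \<le> (\<Sum>(\<zeta>, g)\<in>fit_exceptions D. prob (cylinder \<zeta> g))"
    using finite_measure_subadditive_finite[OF finite_fit_exceptions, of "\<lambda>(\<zeta>, g). cylinder \<zeta> g"] cylinder_sets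
    by (simp add: case_prod_unfold image_subset_iff)
  also have "\<dots> \<le> (\<Sum>(\<zeta>, g)\<in>fit_exceptions D. w \<zeta> * (\<Sum>zB\<in>?Q. q \<zeta> g zB))"
  proof (rule sum_mono, clarify)
    fix \<zeta> g assume K: "(\<zeta>, g) \<in> fit_exceptions D"
    hence \<zeta>g: "\<zeta> \<in> ?L" "g \<in> ?\<G>" using fit_exceptions_subset by blast+
    have "prob (cylinder \<zeta> g) \<le> w \<zeta> * likelihood n T A \<zeta> g"
      unfolding w_def by (rule prob_cylinder_le[OF \<zeta>g])
    also have "\<dots> \<le> w \<zeta> * (\<Sum>zB\<in>?Q. q \<zeta> g zB)"
      by (intro mult_left_mono lik_le K w_nonneg \<zeta>g)
    finally show "prob (cylinder \<zeta> g) \<le> w \<zeta> * (\<Sum>zB\<in>?Q. q \<zeta> g zB)" .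
  qed
  \<comment> \<open>Nonnegative terms are added so that \<open>g\<close> ranges freely and can be
    summed first.\<close>
  also have "\<dots> \<le> (\<Sum>(\<zeta>, g)\<in>?L \<times> ?\<G>. w \<zeta> * (\<Sum>zB\<in>?Q. q \<zeta> g zB))"
  proof (rule sum_mono2)
    fix p assume "p \<in> ?L \<times> ?\<G> - fit_exceptions D"
    then obtain \<zeta> g where p: "p = (\<zeta>, g)" "\<zeta> \<in> ?L" by blast
    have "0 \<le> w \<zeta> * (\<Sum>zB\<in>?Q. q \<zeta> g zB)"
      by (intro mult_nonneg_nonneg sum_nonneg w_nonneg q_nonneg p)
    thus "0 \<le> (case p of (\<zeta>, g) \<Rightarrow> w \<zeta> * (\<Sum>zB\<in>?Q. q \<zeta> g zB))" using p by simp
  qed (rule finite_cartesian_product fin fit_exceptions_subset)+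
  also have "\<dots> = (\<Sum>\<zeta>\<in>?L. \<Sum>g\<in>?\<G>. w \<zeta> * (\<Sum>zB\<in>?Q. q \<zeta> g zB))"
    by (rule sum.cartesian_product[symmetric])
  also have "\<dots> = (\<Sum>\<zeta>\<in>?L. w \<zeta> * (\<Sum>zB\<in>?Q. \<Sum>g\<in>?\<G>. q \<zeta> g zB))"
    by (subst sum.swap) (simp only: sum_distrib_left)
  also have "\<dots> \<le> (\<Sum>\<zeta>\<in>?L. w \<zeta> * (\<Sum>zB\<in>?Q. exp (- D / 4)))"
    by (intro sum_mono mult_left_mono q_sum w_nonneg)
  also have "\<dots> = (\<Sum>\<zeta>\<in>?L. w \<zeta>) * (real (card ?Q) * exp (- D / 4))"
    by (simp only: sum_distrib_right sum_constant)
  \<comment> \<open>The true labeling is averaged with its probabilities, so it contributes no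
    counting factor.\<close>
  also have "(\<Sum>\<zeta>\<in>?L. w \<zeta>) = 1"
    unfolding w_def using \<rho>_sum by (subst prod_sum_PiE[symmetric]) auto
  also have "1 * (real (card ?Q) * exp (- D / 4)) \<le> real nL ^ T * (real T + 1) ^ (2 * n * nL) * exp (- D / 4)"
  proof -
    have "real (card ?Q) = real nL ^ T * real (card (grid_params n nL T))"
      by (simp only: card_cartesian_product of_nat_mult) (simp add: card_PiE)
    also have "\<dots> \<le> real nL ^ T * (real T + 1) ^ (2 * n * nL)"
      by (intro mult_left_mono card_grid_params) simp
    finally show ?thesis by (simp add: mult_right_mono)
  qed
  finally show ?thesis .
qed

subsection \<open>Hub counts\<close>

text \<open>Hoeffding's inequality for a count with mean at least \<open>\<kappa> * T\<close> and a
  shortfall of \<open>\<kappa> * T / 2\<close>. The disjunction treats two counts at once: all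
  groups with hub \<open>a\<close> if \<open>b = a\<close>, and otherwise those that also lack
  \<open>b\<close>.\<close>

lemma prob_few_le:
  assumes a: "a \<in> {1..nL}" and b: "b \<in> {1..nL}" and T: "T > 0"
    and \<kappa>: "0 \<le> \<kappa>" "\<kappa> \<le> \<rho> a" "a \<noteq> b \<Longrightarrow> \<kappa> \<le> \<rho> a * (1 - A a b)"
  defines "few \<equiv> {\<omega>\<in>space M. real (card {t\<in>{1..T}. Z t \<omega> = a \<and> (b = a \<or> \<not> G t b \<omega>)}) \<le> \<kappa> / 2 * real T}"
  shows "few \<in> events" "prob few \<le> exp (- \<kappa>\<^sup>2 * real T / 2)"
proof -
  have bn: "b \<in> {1..n}" using b nL_le_n by auto
  let ?N = "count_space {1..nL} \<Otimes>\<^sub>M (\<Pi>\<^sub>M j\<in>{1..n}. count_space (UNIV :: bool set))"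
  \<comment> \<open>Writing the indicator as a measurable function of hub and membership vector lets
    it inherit independence across groups.\<close>
  define h :: "nat \<times> (nat \<Rightarrow> bool) \<Rightarrow> real" where
    "h x = of_bool (fst x = a \<and> (b = a \<or> \<not> snd x b))" for x
  define X where "X t \<omega> = h (Z t \<omega>, \<lambda>j\<in>{1..n}. G t j \<omega>)" for t \<omega>
  have X_eq: "X t \<omega> = of_bool (Z t \<omega> = a \<and> (b = a \<or> \<not> G t b \<omega>))" for t \<omega>
    using bn by (simp add: X_def h_def)
  have h_meas: "h \<in> borel_measurable ?N"
  proof -
    have 1: "(\<lambda>x. of_bool (fst x = a) :: real) \<in> borel_measurable ?N"
      by (rule measurable_compose[OF measurable_fst]) simp
    have 2: "(\<lambda>x. of_bool (b = a \<or> \<not> snd x b) :: real) \<in> borel_measurable ?N"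
      by (rule measurable_compose[OF measurable_compose[OF measurable_snd measurable_component_singleton[OF bn]]]) simp
    have "h = (\<lambda>x. of_bool (fst x = a) * of_bool (b = a \<or> \<not> snd x b))"
      by (auto simp: h_def fun_eq_iff)
    thus ?thesis using 1 2 by simp
  qed
  interpret H: Hoeffding_ineq M "{1..T}" X "\<lambda>_. 0" "\<lambda>_. 1" "\<Sum>t\<in>{1..T}. expectation (X t)"
  proof unfold_locales
    show "indep_vars (\<lambda>_. borel) X {1..T}"
      unfolding X_def using indep_vars_compose2[OF groups_indep h_meas] .
  qed (auto simp: X_eq)
  have sumX: "(\<Sum>t\<in>{1..T}. X t \<omega>) = real (card {t\<in>{1..T}. Z t \<omega> = a \<and> (b = a \<or> \<not> G t b \<omega>)})" for \<omega>
  proof -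
    have "(\<Sum>t\<in>{1..T}. X t \<omega>) = real (card ({1..T} \<inter> {t. Z t \<omega> = a \<and> (b = a \<or> \<not> G t b \<omega>)}))"
      unfolding X_eq by simp
    also have "{1..T} \<inter> {t. Z t \<omega> = a \<and> (b = a \<or> \<not> G t b \<omega>)}
        = {t\<in>{1..T}. Z t \<omega> = a \<and> (b = a \<or> \<not> G t b \<omega>)}" by auto
    finally show ?thesis .
  qed
  have X_meas: "X t \<in> borel_measurable M" if "t \<in> {1..T}" for t
    using that by (rule H.random_variable)
  have EX: "\<kappa> \<le> expectation (X t)" if t: "t \<in> {1..T}" for t
  proof -
    have "X t -` {1} \<inter> space M \<in> events" using X_meas[OF t] by simp
    hence ev: "{\<omega>\<in>space M. Z t \<omega> = a \<and> (b = a \<or> \<not> G t b \<omega>)} \<in> events"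
      by (rule back_subst[of "\<lambda>S. S \<in> events"]) (auto simp: X_eq)
    have "expectation (X t) = expectation (indicator {\<omega>\<in>space M. Z t \<omega> = a \<and> (b = a \<or> \<not> G t b \<omega>)})"
      by (intro Bochner_Integration.integral_cong refl) (auto simp: X_eq)
    also have "\<dots> = prob {\<omega>\<in>space M. Z t \<omega> = a \<and> (b = a \<or> \<not> G t b \<omega>)}"
      using ev by simp
    also have "\<kappa> \<le> \<dots>"
    proof (cases "a = b")
      case True
      thus ?thesis using hub_prob[OF t a] \<kappa>(2) by simp
    next
      case False
      thus ?thesis using prob_hub_member[OF t a bn, of False] \<kappa>(3) by (simp add: bernoulli_mass_def)
    qed
    finally show ?thesis .
  qed
  have few_eq: "few = {\<omega>\<in>space M. (\<Sum>t\<in>{1..T}. X t \<omega>) \<le> \<kappa> / 2 * real T}"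
    unfolding few_def sumX ..
  show "few \<in> events"
    unfolding few_eq using X_meas by measurable
  have "(\<Sum>t\<in>{1..T}. \<kappa>) \<le> (\<Sum>t\<in>{1..T}. expectation (X t))"
    by (intro sum_mono EX)
  hence \<mu>: "\<kappa> / 2 * real T \<le> (\<Sum>t\<in>{1..T}. expectation (X t)) - \<kappa> / 2 * real T"
    by (simp add: mult.commute)
  \<comment> \<open>By \<open>\<mu>\<close>, the event \<open>few\<close> forces the sum to fall
    short of its mean by at least \<open>\<kappa> / 2 * T\<close>.\<close>
  have "prob few \<le> prob {\<omega>\<in>space M. (\<Sum>t\<in>{1..T}. X t \<omega>) \<le> (\<Sum>t\<in>{1..T}. expectation (X t)) - \<kappa> / 2 * real T}"
    unfolding few_eq
  proof (rule finite_measure_mono)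
    show "{\<omega>\<in>space M. (\<Sum>t\<in>{1..T}. X t \<omega>) \<le> (\<Sum>t\<in>{1..T}. expectation (X t)) - \<kappa> / 2 * real T} \<in> events"
      using X_meas by measurable
  qed (use \<mu> in auto)
  also have "\<dots> \<le> exp (- 2 * (\<kappa> / 2 * real T)\<^sup>2 / (\<Sum>t\<in>{1..T}. (1 - 0)\<^sup>2))"
    using T \<kappa> by (intro H.Hoeffding_ineq_le) auto
  also have "- 2 * (\<kappa> / 2 * real T)\<^sup>2 / (\<Sum>t\<in>{1..T}. (1 - 0)\<^sup>2) = - \<kappa>\<^sup>2 * real T / 2"
    using T by (simp add: power2_eq_square field_simps)
  finally show "prob few \<le> exp (- \<kappa>\<^sup>2 * real T / 2)" .
qed

section \<open>Error probability of the estimator in one model\<close>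

lemma AE_true_labels_feasible: "AE \<omega> in M. feasible nL T (\<lambda>t j. G t j \<omega>) (\<lambda>t. Z t \<omega>)"
proof -
  have "AE \<omega> in M. \<not> (Z t \<omega> = i \<and> G t i \<omega> = False)" if t: "t \<in> {1..T}" and i: "i \<in> {1..nL}" for t i
  proof -
    have i_n: "i \<in> {1..n}" using i nL_le_n by auto
    have "{\<omega>\<in>space M. Z t \<omega> = i \<and> G t i \<omega> = False}
        = {\<omega>\<in>space M. Z t \<omega> = i} \<inter> {\<omega>\<in>space M. G t i \<omega> = False}" by auto
    hence "{\<omega>\<in>space M. Z t \<omega> = i \<and> G t i \<omega> = False} \<in> events"
      using hub_event_sets[OF t, of i] member_event_sets[OF t i_n, of False] by (simp only: sets.Int)
    \<comment> \<open>\<open>A i i = 1\<close>: a hub is almost surely a member of its own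
      group.\<close>
    moreover have "prob {\<omega>\<in>space M. Z t \<omega> = i \<and> G t i \<omega> = False} = 0"
      using prob_hub_member[OF t i i_n, of False] A_diag[OF i] by (simp add: bernoulli_mass_def)
    ultimately show ?thesis
      by (intro AE_I[where N = "{\<omega>\<in>space M. Z t \<omega> = i \<and> G t i \<omega> = False}"])
        (auto simp: emeasure_eq_measure)
  qed
  hence "AE \<omega> in M. \<forall>t\<in>{1..T}. \<forall>i\<in>{1..nL}. \<not> (Z t \<omega> = i \<and> G t i \<omega> = False)"
    by (simp only: AE_ball_countable[OF countable_finite[OF finite_atLeastAtMost]]) blast
  thus ?thesis
  proof (rule AE_mp, intro AE_I2 impI)
    fix \<omega> assume "\<omega> \<in> space M" "\<forall>t\<in>{1..T}. \<forall>i\<in>{1..nL}. \<not> (Z t \<omega> = i \<and> G t i \<omega> = False)"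
    thus "feasible nL T (\<lambda>t j. G t j \<omega>) (\<lambda>t. Z t \<omega>)"
      unfolding feasible_def using Z_range by blast
  qed
qed

text \<open>Three likelihoods are chained: true labels with \<open>A\<close>, true labels with their
  own frequencies, and \<open>z\<close> with its frequencies. The second step uses that the true
  labels compete in the maximization. Restriction places all objects in the finite sets of
  \<open>fit_exceptions\<close>.\<close>

lemma fit_exception_of_mle:
  assumes \<omega>: "\<omega> \<in> space M" and Z: "feasible nL T (\<lambda>t j. G t j \<omega>) (\<lambda>t. Z t \<omega>)"
    and z: "profile_mle n nL T (\<lambda>t j. G t j \<omega>) z"
    and D: "\<And>B. D \<le> sq_distance n T A (\<lambda>t. Z t \<omega>) B z"
  shows "\<omega> \<in> (\<Union>(\<zeta>, g)\<in>fit_exceptions D. cylinder \<zeta> g)"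
proof -
  let ?g = "\<lambda>t j. G t j \<omega>" and ?Z = "\<lambda>t. Z t \<omega>"
  define g where "g = (\<lambda>t\<in>{1..T}. \<lambda>j\<in>{1..n}. G t j \<omega>)"
  define \<zeta> where "\<zeta> = (\<lambda>t\<in>{1..T}. Z t \<omega>)"
  define z' where "z' = restrict z {1..T}"
  define B where "B = (\<lambda>i\<in>{1..nL}. \<lambda>j\<in>{1..n}. A_hat T ?g z i j)"
  have zr: "z t \<in> {1..nL}" if "t \<in> {1..T}" for t
    using z that by (auto simp: profile_mle_def is_arg_max_def feasible_def)
  have "profile_loglik n T ?g ?Z \<le> profile_loglik n T ?g z"
    using z Z by (auto simp: profile_mle_def is_arg_max_def not_less)
  hence le: "likelihood n T (A_hat T ?g ?Z) ?Z ?g \<le> likelihood n T (A_hat T ?g z) z ?g"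
    by (simp flip: exp_profile_loglik)
  have "likelihood n T A \<zeta> g = likelihood n T A ?Z ?g"
    by (rule likelihood_cong) (simp add: \<zeta>_def g_def)
  also have "\<dots> \<le> likelihood n T (A_hat T ?g ?Z) ?Z ?g"
    by (rule likelihood_le_A_hat[OF Z_range[OF _ \<omega>] A_range])
  also note le
  also have "likelihood n T (A_hat T ?g z) z ?g = likelihood n T B z' g"
    by (rule likelihood_cong) (use zr in \<open>simp add: B_def g_def z'_def\<close>)
  finally have lik: "likelihood n T A \<zeta> g \<le> likelihood n T B z' g" .
  have "sq_distance n T A ?Z B z = sq_distance n T A \<zeta> B z'"
    by (rule sq_distance_cong) (simp add: \<zeta>_def z'_def)
  hence "D \<le> sq_distance n T A \<zeta> B z'" using D[of B] by simp
  moreover have "\<zeta> \<in> labelings nL T" using Z_range[OF _ \<omega>] by (auto simp: \<zeta>_def)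
  moreover have "g \<in> groupings n T" by (auto simp: g_def)
  moreover have "z' \<in> labelings nL T" using zr by (auto simp: z'_def)
  moreover have "B \<in> grid_params n nL T" by (auto simp: B_def A_hat_in_fraction_grid)
  ultimately have "(\<zeta>, g) \<in> fit_exceptions D" using lik unfolding fit_exceptions_def by blast
  moreover have "\<omega> \<in> cylinder \<zeta> g" using \<omega> by (auto simp: cylinder_def \<zeta>_def g_def)
  ultimately show ?thesis by blast
qed

text \<open>Almost surely, more than \<open>s\<close> mislabeled groups imply that some count is too
  small or that the configuration is exceptional. Here \<open>x\<close> is the overlap threshold,
  \<open>y\<close> the number of separating columns, and \<open>\<kappa>\<close> bounds the mean
  frequencies behind the counts.\<close>

lemma prob_mislabeled_le:
  assumes T: "T > 0"
    and mle: "AE \<omega> in M. profile_mle n nL T (\<lambda>t j. G t j \<omega>) (\<lambda>t. zhat t \<omega>)"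
    and \<kappa>: "0 \<le> \<kappa>" "\<And>a. a \<in> {1..nL} \<Longrightarrow> \<kappa> \<le> \<rho> a"
      "\<And>a b. a \<in> {1..nL} \<Longrightarrow> b \<in> {1..nL} \<Longrightarrow> a \<noteq> b \<Longrightarrow> \<kappa> \<le> \<rho> a * (1 - A a b)"
    and x: "0 \<le> x" "real nL * x \<le> \<kappa> / 2 * real T"
    and s: "real nL * (real nL * x) \<le> s"
    and d: "0 \<le> d"
    and sep: "\<And>i. i \<in> {1..nL} \<Longrightarrow> \<exists>V\<subseteq>{1..n}. y \<le> real (card V) \<and>
            (\<forall>j\<in>V. \<forall>i'\<in>{1..nL}. i' \<noteq> i \<longrightarrow> A i j - A i' j \<ge> d)"
  shows "prob {\<omega>\<in>space M. s < real (mislabeled T (\<lambda>t. Z t \<omega>) (\<lambda>t. zhat t \<omega>))}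
    \<le> (real nL)\<^sup>2 * exp (- \<kappa>\<^sup>2 * real T / 2)
      + real nL ^ T * (real T + 1) ^ (2 * n * nL) * exp (- (x * y * d\<^sup>2) / 8)"
proof -
  define few where "few p = {\<omega>\<in>space M.
    real (card {t\<in>{1..T}. Z t \<omega> = fst p \<and> (snd p = fst p \<or> \<not> G t (snd p) \<omega>)}) \<le> \<kappa> / 2 * real T}" for p
  \<comment> \<open>The distance guaranteed by \<open>sq_distance_ge\<close>; with the factor 1/4
    from the affinity bound it yields the 8 in the exponent.\<close>
  define D where "D = x * y * d\<^sup>2 / 2"
  let ?I = "{1..nL} \<times> {1..nL}"
  let ?F = "\<Union>p\<in>?I. few p" and ?E = "\<Union>(\<zeta>, g)\<in>fit_exceptions D. cylinder \<zeta> g"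
  have few: "few p \<in> events" "prob (few p) \<le> exp (- \<kappa>\<^sup>2 * real T / 2)" if "p \<in> ?I" for p
  proof -
    have p: "fst p \<in> {1..nL}" "snd p \<in> {1..nL}" using that by auto
    show "few p \<in> events" "prob (few p) \<le> exp (- \<kappa>\<^sup>2 * real T / 2)"
      unfolding few_def using prob_few_le[OF p T \<kappa>(1) \<kappa>(2)[OF p(1)] \<kappa>(3)[OF p]] by blast+
  qed
  have F: "?F \<in> events" using few by (intro sets.finite_UN) auto
  have E: "?E \<in> events"
    using cylinder_sets finite_fit_exceptions by (intro sets.finite_UN) auto
  have "prob {\<omega>\<in>space M. s < real (mislabeled T (\<lambda>t. Z t \<omega>) (\<lambda>t. zhat t \<omega>))}
      \<le> prob (?F \<union> ?E)"
  proof (rule finite_measure_mono_AE)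
    show "AE \<omega> in M. \<omega> \<in> {\<omega>\<in>space M. s < real (mislabeled T (\<lambda>t. Z t \<omega>) (\<lambda>t. zhat t \<omega>))}
      \<longrightarrow> \<omega> \<in> ?F \<union> ?E"
      using mle AE_true_labels_feasible
    proof eventually_elim
      case (elim \<omega>)
      show ?case
      proof (intro impI)
        assume "\<omega> \<in> {\<omega>\<in>space M. s < real (mislabeled T (\<lambda>t. Z t \<omega>) (\<lambda>t. zhat t \<omega>))}"
        hence \<omega>: "\<omega> \<in> space M"
          and mis: "real nL * (real nL * x) < real (mislabeled T (\<lambda>t. Z t \<omega>) (\<lambda>t. zhat t \<omega>))"
          using s by auto
        show "\<omega> \<in> ?F \<union> ?E"
        proof (cases "\<omega> \<in> ?F")
          case False
          have many: "real nL * x < real (card {t\<in>{1..T}. Z t \<omega> = a \<and> (b = a \<or> \<not> G t b \<omega>)})"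
            if "a \<in> {1..nL}" "b \<in> {1..nL}" for a b
          proof -
            have "(a, b) \<in> ?I" using that by simp
            hence "\<omega> \<notin> few (a, b)" using False by blast
            thus ?thesis using \<omega> x(2) by (simp add: few_def)
          qed
          have zh: "feasible nL T (\<lambda>t j. G t j \<omega>) (\<lambda>t. zhat t \<omega>)"
            using elim(1) by (simp add: profile_mle_def is_arg_max_def)
          have "D \<le> sq_distance n T A (\<lambda>t. Z t \<omega>) B (\<lambda>t. zhat t \<omega>)" for B
            unfolding D_def by (rule sq_distance_ge[OF Z_range[OF _ \<omega>] zh many mis d x(1) sep])
          hence "\<omega> \<in> ?E" by (rule fit_exception_of_mle[OF \<omega> elim(2,1)])
          thus ?thesis by blast
        qed blast
      qed
    qed
  qed (use E F in auto)
  also have "\<dots> \<le> prob ?F + prob ?E"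
    using F E by (rule measure_Un_le)
  also have "prob ?F \<le> (\<Sum>p\<in>?I. prob (few p))"
    using few by (intro finite_measure_subadditive_finite) auto
  also have "\<dots> \<le> (\<Sum>p\<in>?I. exp (- \<kappa>\<^sup>2 * real T / 2))"
    using few(2) by (rule sum_mono)
  also have "\<dots> = (real nL)\<^sup>2 * exp (- \<kappa>\<^sup>2 * real T / 2)"
    by (simp add: card_cartesian_product power2_eq_square)
  also have "prob ?E \<le> real nL ^ T * (real T + 1) ^ (2 * n * nL) * exp (- D / 4)"
    by (rule prob_fit_exceptions_le)
  also have "- D / 4 = - (x * y * d\<^sup>2) / 8" by (simp add: D_def)
  finally show ?thesis by simp
qed

end

subsection \<open>Asymptotics\<close>

text \<open>All exponents are measured in units of \<open>W = T * n * v * d\<^sup>2\<close>.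
  Labelings cost \<open>ln nL / u\<close> units and grid matrices at most \<open>4 * nL * r\<close>
  units. Both tend to 0, since \<open>u\<close> diverges and \<open>r\<close> is the vanishing ratio
  in \<open>T_rate\<close>, so the gain \<open>c\<close> prevails.\<close>

lemma union_bound_tendsto_0:
  fixes n T :: "nat \<Rightarrow> nat" and d v :: "nat \<Rightarrow> real" and nL :: nat
  assumes nL: "nL > 0" and c: "c > 0"
    and T_lim: "filterlim T at_top sequentially"
    and d: "\<And>m. 0 < d m \<and> d m \<le> 1" and v: "\<And>m. 0 < v m \<and> v m \<le> 1"
    and T_rate: "(\<lambda>m. ln (real (T m)) / ((d m)^2 * v m * real (T m))) \<longlonglongrightarrow> 0"
    and n_rate: "filterlim (\<lambda>m. (d m)^4 * (v m)^2 * real (n m)) at_top sequentially"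
  shows "(\<lambda>m. real nL ^ T m * (real (T m) + 1) ^ (2 * n m * nL)
      * exp (- (c * (real (T m) * real (n m) * v m * (d m)\<^sup>2)))) \<longlonglongrightarrow> 0"
proof -
  define u where "u m = (d m)\<^sup>2 * v m * real (n m)" for m
  define W where "W m = real (T m) * u m" for m
  define r where "r m = ln (real (T m)) / ((d m)\<^sup>2 * v m * real (T m))" for m
  have u_lim: "filterlim u at_top sequentially"
  proof (rule filterlim_at_top_mono[OF n_rate], rule always_eventually, rule allI)
    fix m
    \<comment> \<open>The quantity in \<open>n_rate\<close> is \<open>u\<close> times this factor,
      so \<open>u\<close> diverges too.\<close>
    have "(d m)\<^sup>2 * v m \<le> 1" using d[of m] v[of m] by (intro mult_le_one power_le_one) auto
    hence "((d m)\<^sup>2 * v m) * ((d m)\<^sup>2 * v m * real (n m)) \<le> 1 * ((d m)\<^sup>2 * v m * real (n m))"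
      using d[of m] v[of m] by (intro mult_right_mono) auto
    thus "(d m)^4 * (v m)^2 * real (n m) \<le> u m"
      by (simp add: u_def power2_eq_square power4_eq_xxxx mult_ac)
  qed
  have T_real: "filterlim (\<lambda>m. real (T m)) at_top sequentially"
    by (rule filterlim_compose[OF filterlim_real_sequentially T_lim])
  have W_lim: "filterlim W at_top sequentially"
    unfolding W_def by (rule filterlim_at_top_mult_at_top[OF T_real u_lim])
  have u_inv: "(\<lambda>m. ln (real nL) / u m) \<longlonglongrightarrow> 0"
    by (rule tendsto_divide_0[OF tendsto_const filterlim_at_top_imp_at_infinity[OF u_lim]])
  have r_lim: "r \<longlonglongrightarrow> 0" using T_rate by (simp add: r_def[abs_def])
  have "(\<lambda>m. c - ln (real nL) / u m - 4 * real nL * r m) \<longlonglongrightarrow> c - 0 - 4 * real nL * 0"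
    by (intro tendsto_intros u_inv r_lim)
  hence "filterlim (\<lambda>m. (c - ln (real nL) / u m - 4 * real nL * r m) * W m) at_top sequentially"
    using c by (intro filterlim_tendsto_pos_mult_at_top[OF _ _ W_lim]) auto
  hence lim: "(\<lambda>m. exp (- ((c - ln (real nL) / u m - 4 * real nL * r m) * W m))) \<longlonglongrightarrow> 0"
    by (intro filterlim_compose[OF exp_at_bot] filterlim_compose[OF filterlim_uminus_at_bot_at_top])
  have "\<forall>\<^sub>F m in sequentially. T m \<ge> 2" "\<forall>\<^sub>F m in sequentially. u m \<ge> 1"
    using T_lim u_lim by (simp_all add: filterlim_at_top)
  hence "\<forall>\<^sub>F m in sequentially. real nL ^ T m * (real (T m) + 1) ^ (2 * n m * nL)
      * exp (- (c * (real (T m) * real (n m) * v m * (d m)\<^sup>2)))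
      \<le> exp (- ((c - ln (real nL) / u m - 4 * real nL * r m) * W m))"
  proof eventually_elim
    case (elim m)
    have "real nL ^ T m = exp (real (T m) * ln (real nL))"
      using nL by (simp add: exp_of_nat_mult)
    also have "real (T m) * ln (real nL) = ln (real nL) / u m * W m"
      using elim by (simp add: W_def)
    finally have 1: "real nL ^ T m = exp (ln (real nL) / u m * W m)" .
    \<comment> \<open>This trades \<open>ln (T + 1)\<close> for \<open>2 * ln T\<close> and so turns
      the exponent 2 into 4.\<close>
    have "real (T m) + 1 \<le> (real (T m))\<^sup>2"
    proof -
      have "2 * real (T m) \<le> real (T m) * real (T m)"
        using elim by (intro mult_right_mono) auto
      moreover have "2 \<le> real (T m)" using elim by simp
      ultimately show ?thesis unfolding power2_eq_square by linarith
    qed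
    hence "(real (T m) + 1) ^ (2 * n m * nL) \<le> ((real (T m))\<^sup>2) ^ (2 * n m * nL)"
      by (intro power_mono) auto
    also have "\<dots> = real (T m) ^ (4 * n m * nL)"
      by (simp flip: power_mult add: mult_ac)
    also have "\<dots> = exp (real (4 * n m * nL) * ln (real (T m)))"
      using elim by (simp only: exp_of_nat_mult) simp
    also have "real (4 * n m * nL) * ln (real (T m)) = 4 * real nL * r m * W m"
      using elim d[of m] v[of m] by (simp add: r_def W_def u_def)
    finally have 2: "(real (T m) + 1) ^ (2 * n m * nL) \<le> exp (4 * real nL * r m * W m)" .
    have "real nL ^ T m * (real (T m) + 1) ^ (2 * n m * nL)
        * exp (- (c * (real (T m) * real (n m) * v m * (d m)\<^sup>2)))
      \<le> exp (ln (real nL) / u m * W m) * exp (4 * real nL * r m * W m) * exp (- (c * W m))"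
      using 2 by (intro mult_mono) (auto simp: 1 W_def u_def mult_ac)
    also have "\<dots> = exp (- ((c - ln (real nL) / u m - 4 * real nL * r m) * W m))"
      by (simp flip: exp_add add: algebra_simps)
    finally show ?case .
  qed
  thus ?thesis
    by (intro tendsto_sandwich[OF _ _ tendsto_const lim]) (auto intro!: always_eventually)
qed

theorem theorem4:
  fixes M :: "nat \<Rightarrow> 'a measure"
    and nL :: nat
    and n T :: "nat \<Rightarrow> nat"
    and \<rho> :: "nat \<Rightarrow> nat \<Rightarrow> real"
    and A :: "nat \<Rightarrow> nat \<Rightarrow> nat \<Rightarrow> real"
    and Z :: "nat \<Rightarrow> nat \<Rightarrow> 'a \<Rightarrow> nat"
    and G :: "nat \<Rightarrow> nat \<Rightarrow> nat \<Rightarrow> 'a \<Rightarrow> bool"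
    and zhat :: "nat \<Rightarrow> nat \<Rightarrow> 'a \<Rightarrow> nat"
    and d v :: "nat \<Rightarrow> real"
    and cmin cmax \<delta> :: real
  assumes model: "\<And>m. asymmetric_hub_model (M m) (n m) nL (T m) (\<rho> m) (A m) (Z m) (G m)"
    and n_lim: "filterlim n at_top sequentially"
    and T_lim: "filterlim T at_top sequentially"
    and c_pos: "cmin > 0" "cmax > 0"
    and \<rho>_min: "\<And>m. Min (\<rho> m ` {1..nL}) = cmin / real nL"
    and \<rho>_max: "\<And>m. Max (\<rho> m ` {1..nL}) = cmax / real nL"
    and zhat_rv: "\<And>m t. t \<in> {1..T m} \<Longrightarrow> zhat m t \<in> measurable (M m) (count_space UNIV)"
    and zhat_mle: "\<And>m. AE \<omega> in M m.
          profile_mle (n m) nL (T m) (\<lambda>t j. G m t j \<omega>) (\<lambda>t. zhat m t \<omega>)"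
    and d_range: "\<And>m. 0 < d m \<and> d m \<le> 1"
    and v_range: "\<And>m. 0 < v m \<and> v m \<le> 1"
    and separation: "\<And>m i. i \<in> {1..nL} \<Longrightarrow>
          \<exists>V \<subseteq> {1..n m}. real (card V) \<ge> v m * real (n m) / real nL \<and>
            (\<forall>j\<in>V. \<forall>i'\<in>{1..nL}. i' \<noteq> i \<longrightarrow> A m i j - A m i' j \<ge> d m)"
    and \<delta>_pos: "\<delta> > 0"
    and bounded_away: "\<And>m i i'. i \<in> {1..nL} \<Longrightarrow> i' \<in> {1..nL} \<Longrightarrow> i \<noteq> i' \<Longrightarrow> A m i i' \<le> 1 - \<delta>"
    and T_rate: "(\<lambda>m. ln (real (T m)) / ((d m)^2 * v m * real (T m))) \<longlonglongrightarrow> 0"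
    and n_rate: "filterlim (\<lambda>m. (d m)^4 * (v m)^2 * real (n m)) at_top sequentially"
  shows "vanishes_in_prob M
           (\<lambda>m \<omega>. real (mislabeled (T m) (\<lambda>t. Z m t \<omega>) (\<lambda>t. zhat m t \<omega>)) / real (T m))"
proof -
  have nL: "nL > 0"
    using asymmetric_hub_model.\<rho>_sum[OF model[of 0]] by (cases nL) auto
  \<comment> \<open>A lower bound independent of \<open>m\<close> for both kinds of frequency:
    \<open>\<delta>\<close> bounds the chance that hub \<open>a\<close> omits \<open>b\<close>, and
    the minimum with 1 covers the count of all groups with hub \<open>a\<close>.\<close>
  define \<kappa> where "\<kappa> = cmin * min \<delta> 1 / real nL"
  have \<kappa>_pos: "\<kappa> > 0" using c_pos \<delta>_pos nL by (simp add: \<kappa>_def)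
  have \<rho>_ge: "cmin / real nL \<le> \<rho> m a" if "a \<in> {1..nL}" for m a
    using that \<rho>_min[of m] by (metis Min_le finite_atLeastAtMost finite_imageI imageI)
  have \<kappa>_le: "\<kappa> \<le> \<rho> m a * s" if "a \<in> {1..nL}" "min \<delta> 1 \<le> s" for m a s
  proof -
    have "cmin / real nL * min \<delta> 1 \<le> \<rho> m a * s"
      using \<rho>_ge[OF that(1), of m] that(2) c_pos \<delta>_pos nL
      by (intro mult_mono) (auto intro: order_trans[rotated])
    thus ?thesis by (simp add: \<kappa>_def)
  qed
  show ?thesis
    unfolding vanishes_in_prob_def
  proof (intro allI impI)
    fix \<epsilon> :: real assume \<epsilon>: "\<epsilon> > 0"
    \<comment> \<open>With overlap threshold \<open>\<eta> * T\<close>, the two bounds in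
      \<open>\<eta>_le\<close> keep the mislabeling threshold within \<open>\<epsilon> * T\<close>
      and the pigeonhole requirement within \<open>\<kappa> / 2 * T\<close>.\<close>
    define \<eta> where "\<eta> = min (\<kappa> / 2) \<epsilon> / (real nL)\<^sup>2"
    have \<eta>_pos: "\<eta> > 0" using \<kappa>_pos \<epsilon> nL by (simp add: \<eta>_def)
    have \<eta>_le: "(real nL)\<^sup>2 * \<eta> \<le> \<epsilon>" "real nL * \<eta> \<le> \<kappa> / 2"
    proof -
      show "(real nL)\<^sup>2 * \<eta> \<le> \<epsilon>" using nL by (simp add: \<eta>_def)
      have "real nL * \<eta> \<le> real nL * (real nL * \<eta>)"
        using nL \<eta>_pos mult_right_mono[of 1 "real nL" "real nL * \<eta>"] by simp
      also have "\<dots> \<le> \<kappa> / 2" using nL by (simp add: \<eta>_def power2_eq_square)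
      finally show "real nL * \<eta> \<le> \<kappa> / 2" .
    qed
    let ?P = "\<lambda>m. \<P>(\<omega> in M m. \<bar>real (mislabeled (T m) (\<lambda>t. Z m t \<omega>) (\<lambda>t. zhat m t \<omega>)) / real (T m)\<bar> > \<epsilon>)"
    let ?C = "\<lambda>m. (real nL)\<^sup>2 * exp (- \<kappa>\<^sup>2 * real (T m) / 2)"
    let ?U = "\<lambda>m. real nL ^ T m * (real (T m) + 1) ^ (2 * n m * nL)
      * exp (- (\<eta> / (8 * real nL) * (real (T m) * real (n m) * v m * (d m)\<^sup>2)))"
    have bound: "?P m \<le> ?C m + ?U m" if T: "T m > 0" for m
    proof -
      interpret asymmetric_hub_model "M m" "n m" nL "T m" "\<rho> m" "A m" "Z m" "G m"
        by (rule model)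
      let ?x = "\<eta> * real (T m)" and ?y = "v m * real (n m) / real nL"
      let ?mis = "\<lambda>\<omega>. mislabeled (T m) (\<lambda>t. Z m t \<omega>) (\<lambda>t. zhat m t \<omega>)"
      have "prob {\<omega>\<in>space (M m). \<epsilon> * real (T m) < real (?mis \<omega>)}
        \<le> ?C m + real nL ^ T m * (real (T m) + 1) ^ (2 * n m * nL) * exp (- (?x * ?y * (d m)\<^sup>2) / 8)"
      proof (rule prob_mislabeled_le[OF T zhat_mle])
        show "\<kappa> \<le> \<rho> m a" if "a \<in> {1..nL}" for a
          using \<kappa>_le[OF that, of 1 m] by simp
        show "\<kappa> \<le> \<rho> m a * (1 - A m a b)" if "a \<in> {1..nL}" "b \<in> {1..nL}" "a \<noteq> b" for a b
          using bounded_away[OF that, of m] by (intro \<kappa>_le that(1)) auto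
        show "real nL * (real nL * ?x) \<le> \<epsilon> * real (T m)"
          using mult_right_mono[OF \<eta>_le(1), of "real (T m)"] by (simp add: power2_eq_square mult.assoc)
        show "real nL * ?x \<le> \<kappa> / 2 * real (T m)"
          using mult_right_mono[OF \<eta>_le(2), of "real (T m)"] by (simp add: mult.assoc)
      qed (use \<kappa>_pos \<eta>_pos d_range[of m] separation[of _ m] in auto)
      moreover have "exp (- (?x * ?y * (d m)\<^sup>2) / 8)
          = exp (- (\<eta> / (8 * real nL) * (real (T m) * real (n m) * v m * (d m)\<^sup>2)))"
        by (simp add: mult_ac)
      moreover have "\<bar>real (?mis \<omega>) / real (T m)\<bar> > \<epsilon> \<longleftrightarrow> \<epsilon> * real (T m) < real (?mis \<omega>)" for \<omega>
        using T by (simp add: field_simps)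
      ultimately show ?thesis by simp
    qed
    have T_real: "filterlim (\<lambda>m. real (T m)) at_top sequentially"
      by (rule filterlim_compose[OF filterlim_real_sequentially T_lim])
    have "filterlim (\<lambda>m. \<kappa>\<^sup>2 / 2 * real (T m)) at_top sequentially"
      using \<kappa>_pos by (intro filterlim_tendsto_pos_mult_at_top[OF tendsto_const _ T_real]) simp
    hence "(\<lambda>m. exp (- (\<kappa>\<^sup>2 / 2 * real (T m)))) \<longlonglongrightarrow> 0"
      by (intro filterlim_compose[OF exp_at_bot] filterlim_compose[OF filterlim_uminus_at_bot_at_top])
    hence "(\<lambda>m. (real nL)\<^sup>2 * exp (- (\<kappa>\<^sup>2 / 2 * real (T m)))) \<longlonglongrightarrow> (real nL)\<^sup>2 * 0"
      by (rule tendsto_mult_left)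
    hence C: "?C \<longlonglongrightarrow> 0" by simp
    have U: "?U \<longlonglongrightarrow> 0"
      using \<eta>_pos nL by (intro union_bound_tendsto_0[OF nL _ T_lim d_range v_range T_rate n_rate]) simp
    have lim: "(\<lambda>m. ?C m + ?U m) \<longlonglongrightarrow> 0"
      using tendsto_add[OF C U] by simp
    \<comment> \<open>\<open>bound\<close> divides by \<open>T m\<close>, so it is available only
      from some index on.\<close>
    have "\<forall>\<^sub>F m in sequentially. 1 \<le> T m"
      using T_lim by (simp add: filterlim_at_top)
    hence "\<forall>\<^sub>F m in sequentially. ?P m \<le> ?C m + ?U m"
      by eventually_elim (rule bound, simp)
    thus "?P \<longlonglongrightarrow> 0"
      by (intro tendsto_sandwich[OF _ _ tendsto_const lim]) (auto intro!: always_eventually)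
  qed
qed

end
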